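(* Consider the branching particle system on $\mathbb{R}$ described in the context, with parameters $\lambda>0$, $\alpha>0$, $\gamma\in(0,1)$ and jump distribution $\nu$, and let $M(t)$ be the position of its right-most particle at time $t$. Then there exist constants $K_3,K_4>0$ such that $$K_3\ \ge\ \limsup_{t\to\infty}\frac{\log M(t)}{t^{\frac{1}{1-\gamma}}}\ \ge\ \liminf_{t\to\infty}\frac{\log M(t)}{t^{\frac{1}{1-\gamma}}}\ \ge\ K_4\qquad\text{a.s.}$$ Moreover one can take $K_3=\left(\frac{2}{\alpha}\right)^{\frac{1}{1-\gamma}}$ and $K_4=\left(\frac{2^{1-\gamma}-1}{4D\alpha}\right)^{\frac{1}{1-\gamma}}$, where $D=D(\nu)>0$ is a constant, depending only on $\nu$, such that $\nu\left((e^{n+k}-e^n,\infty)\right)\ge e^{-(n+k)D\alpha}$ for all $n,k\in\mathbb{N}$ (such a constant exists).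
   Context: $\mathbb{N}=\{1,2,\dots\}$. Jump measure: $\nu$ is a probability measure on $\mathbb{R}$ with $\nu((-\infty,0))=0$ and $\lim_{x\to\infty}\frac{\nu([x,+\infty))}{x^{-\alpha}L(x)}=1$ for some $\alpha>0$ and some slowly varying function $L:(0,\infty)\to(0,\infty)$. Model: at time $0$ there is a single particle at position $e$ (Euler's number). Motion: each particle moves as a compound Poisson process with intensity $\lambda>0$ and jump law $\nu$; that is, if a particle is at $Y(\tau)$ at time $\tau$, then $Y(\tau+h)=Y(\tau)+\sum_{i\le N(h)}\xi_i$ for $h>0$, where $N$ is a Poisson process with intensity $\lambda$ and $(\xi_i)$ are i.i.d. with law $\nu$, with $N$, $(\xi_i)$ and the process up to time $\tau$ independent. In particular trajectories are nondecreasing. Branching: a particle created at time $\tau$ with trajectory $Y$ receives an independent clock $\mathcal{E}\sim Exp(1)$ (exponential with mean 1); at time $\tau+T$, where $T=\inf\{h>0: \int_\tau^{\tau+h}(\log Y(u))^\gamma\,du=\mathcal{E}\}$ and $\gamma\in(0,1)$, it produces one descendant at its current location, which follows the same dynamics; at time $\tau+T$ the particles receive new independent clocks. All particles behave independently. $X(t)$ denotes the set of particles at time $t$, $Y_r(t)$ the position of $r\in X(t)$, and $M(t)=\sup\{Y_r(t): r\in X(t)\}$. *)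

theory Defs
  imports "HOL-Probability.Probability"
begin

section \<open>Jump law\<close>

definition slowly_varying :: "(real \<Rightarrow> real) \<Rightarrow> bool" where
  "slowly_varying L \<longleftrightarrow>
     (\<forall>x>0. L x > 0) \<and> (\<forall>c>0. ((\<lambda>x. L (c * x) / L x) \<longlongrightarrow> 1) at_top)"

definition tail_constant :: "real measure \<Rightarrow> real \<Rightarrow> real \<Rightarrow> bool" where
  "tail_constant \<nu> \<alpha> D \<longleftrightarrow>
     (\<forall>n k :: nat. n \<ge> 1 \<longrightarrow> k \<ge> 1 \<longrightarrow>
        measure \<nu> {exp (real (n + k)) - exp (real n) <..} \<ge> exp (- (real (n + k) * D * \<alpha>)))"

section \<open>Driving randomness\<close>

definition poisson_process :: "'w measure \<Rightarrow> real \<Rightarrow> (real \<Rightarrow> 'w \<Rightarrow> nat) \<Rightarrow> bool" where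
  "poisson_process P rate N \<longleftrightarrow>
     (\<forall>t\<ge>0. N t \<in> measurable P (count_space UNIV)) \<and>
     (\<forall>\<omega>\<in>space P. N 0 \<omega> = 0 \<and> mono_on {0..} (\<lambda>t. N t \<omega>) \<and>
        (\<forall>t\<ge>0. continuous (at_right t) (\<lambda>s. N s \<omega>))) \<and>
     (\<forall>s t. 0 \<le> s \<longrightarrow> s < t \<longrightarrow>
        distr P (count_space UNIV) (\<lambda>\<omega>. N t \<omega> - N s \<omega>)
          = measure_pmf (poisson_pmf (rate * (t - s)))) \<and>
     (\<forall>(t :: nat \<Rightarrow> real) n. 0 \<le> t 0 \<longrightarrow> mono t \<longrightarrow>
        prob_space.indep_vars P (\<lambda>_. count_space UNIV)
          (\<lambda>i \<omega>. N (t (Suc i)) \<omega> - N (t i) \<omega>) {..<n})"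

text \<open>
  Particles are labelled by lists: \<open>[]\<close> is the initial particle, and \<open>k # u\<close> is the descendant
  produced by particle \<open>u\<close> at its branching number \<open>k\<close>, counted from \<open>0\<close> (so the youngest
  generation is at the head of the list).  A particle keeps its label when it produces a descendant.
\<close>

type_synonym label = "nat list"

datatype source = Arrivals label | Jump label nat | Clock label nat

text \<open>
  Particle \<open>u\<close> owns a Poisson process \<open>N u\<close>, run in the time elapsed since the birth of \<open>u\<close>, jump
  sizes \<open>\<xi> u 0, \<xi> u 1, \<dots>\<close>, and clocks: \<open>\<E> u 0\<close> is received at birth and \<open>\<E> u (Suc k)\<close>
  immediately after branching number \<open>k\<close>.
\<close>

fun source_events ::
  "'w measure \<Rightarrow> (label \<Rightarrow> real \<Rightarrow> 'w \<Rightarrow> nat) \<Rightarrow> (label \<Rightarrow> nat \<Rightarrow> 'w \<Rightarrow> real) \<Rightarrow>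
   (label \<Rightarrow> nat \<Rightarrow> 'w \<Rightarrow> real) \<Rightarrow> source \<Rightarrow> 'w set set" where
  "source_events P N \<xi> \<E> (Arrivals u) =
     sigma_sets (space P) {N u t -` A \<inter> space P | t A. 0 \<le> t}"
| "source_events P N \<xi> \<E> (Jump u i) = {\<xi> u i -` B \<inter> space P | B. B \<in> sets borel}"
| "source_events P N \<xi> \<E> (Clock u k) = {\<E> u k -` B \<inter> space P | B. B \<in> sets borel}"

locale branching_randomness = prob_space P
  for P :: "'w measure" +
  fixes rate :: real
    and \<nu> :: "real measure"
    and N :: "label \<Rightarrow> real \<Rightarrow> 'w \<Rightarrow> nat"
    and \<xi> :: "label \<Rightarrow> nat \<Rightarrow> 'w \<Rightarrow> real"
    and \<E> :: "label \<Rightarrow> nat \<Rightarrow> 'w \<Rightarrow> real"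
  assumes arrivals: "\<And>u. poisson_process P rate (N u)"
    and jumps_measurable: "\<And>u i. \<xi> u i \<in> borel_measurable P"
    and jumps: "\<And>u i. distr P borel (\<xi> u i) = \<nu>"
    and clocks: "\<And>u k. distributed P lborel (\<E> u k) (exponential_density 1)"
    and independent: "indep_sets (source_events P N \<xi> \<E>) UNIV"

section \<open>The particle system\<close>

text \<open>
  \<open>branching_time \<gamma> Y \<tau> c k\<close> is the time of the \<open>k\<close>-th branching, counted from \<open>1\<close>, of a particle
  born at time \<open>\<tau>\<close> with trajectory \<open>Y\<close> and successive clocks \<open>c 0, c 1, \<dots>\<close>; the value at \<open>0\<close> is
  the birth time.
\<close>

primrec branching_time ::
  "real \<Rightarrow> (real \<Rightarrow> real) \<Rightarrow> real \<Rightarrow> (nat \<Rightarrow> real) \<Rightarrow> nat \<Rightarrow> real" where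
  "branching_time \<gamma> Y \<tau> c 0 = \<tau>"
| "branching_time \<gamma> Y \<tau> c (Suc k) =
     (let \<sigma> = branching_time \<gamma> Y \<tau> c k
      in \<sigma> + Inf {h. h > 0 \<and> (LBINT s:{\<sigma>..\<sigma> + h}. ln (Y s) powr \<gamma>) = c k})"

definition compound_sum :: "(real \<Rightarrow> nat) \<Rightarrow> (nat \<Rightarrow> real) \<Rightarrow> real \<Rightarrow> real" where
  "compound_sum n x h = (\<Sum>i<n h. x i)"

text \<open>
  Birth time and trajectory of a particle, for one realisation \<open>n\<close>, \<open>x\<close>, \<open>c\<close> of the randomness.
  The trajectory is meaningful only from the birth time onwards.
\<close>

primrec particle ::
  "real \<Rightarrow> (label \<Rightarrow> real \<Rightarrow> nat) \<Rightarrow> (label \<Rightarrow> nat \<Rightarrow> real) \<Rightarrow> (label \<Rightarrow> nat \<Rightarrow> real) \<Rightarrow>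
   label \<Rightarrow> real \<times> (real \<Rightarrow> real)" where
  "particle \<gamma> n x c [] = (0, \<lambda>t. exp 1 + compound_sum (n []) (x []) t)"
| "particle \<gamma> n x c (k # u) =
     (let (\<tau>, Y) = particle \<gamma> n x c u; \<tau>' = branching_time \<gamma> Y \<tau> (c u) (Suc k)
      in (\<tau>', \<lambda>t. Y \<tau>' + compound_sum (n (k # u)) (x (k # u)) (t - \<tau>')))"

definition birth where
  "birth \<gamma> N \<xi> \<E> u \<omega> =
     fst (particle \<gamma> (\<lambda>v t. N v t \<omega>) (\<lambda>v i. \<xi> v i \<omega>) (\<lambda>v k. \<E> v k \<omega>) u)"

definition position where
  "position \<gamma> N \<xi> \<E> u t \<omega> =
     snd (particle \<gamma> (\<lambda>v t. N v t \<omega>) (\<lambda>v i. \<xi> v i \<omega>) (\<lambda>v k. \<E> v k \<omega>) u) t"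

definition alive where
  "alive \<gamma> N \<xi> \<E> t \<omega> = {u. birth \<gamma> N \<xi> \<E> u \<omega> \<le> t}"

text \<open>
  The supremum is taken in the extended reals because it is not known a priori that only finitely
  many particles are present at a given time.
\<close>

definition rightmost where
  "rightmost \<gamma> N \<xi> \<E> t \<omega> =
     (SUP u \<in> alive \<gamma> N \<xi> \<E> t \<omega>. ereal (position \<gamma> N \<xi> \<E> u t \<omega>))"

definition ln_ereal :: "ereal \<Rightarrow> ereal" where
  "ln_ereal m = (case m of ereal r \<Rightarrow> if r > 0 then ereal (ln r) else -\<infinity> | PInfty \<Rightarrow> \<infinity> | MInfty \<Rightarrow> -\<infinity>)"

definition normalized_log_max where
  "normalized_log_max \<gamma> N \<xi> \<E> \<omega> t =
     ln_ereal (rightmost \<gamma> N \<xi> \<E> t \<omega>) / ereal (t powr (1 / (1 - \<gamma>)))"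

end

theory Submission
  imports Defs "HOL-Real_Asymp.Real_Asymp"
begin

text \<open>
  Upper bound: while a line of descent stays below \<open>exp x\<close>, its branching rate is at most
  \<open>x powr \<gamma>\<close>. So if some particle is above \<open>exp x\<close> at time \<open>t\<close>, there is a label whose clocks along
  its lineage sum to at most \<open>x powr \<gamma> * t\<close>, while the compound sums of its ancestors, all run up to
  time \<open>t\<close>, add up to at least \<open>exp x\<close>. The two conditions are independent; the number of labels of
  generation \<open>n\<close> with clock sum at most \<open>a\<close> has mean \<open>a ^ n / fact n\<close>, as in a Yule tree, and the jump
  condition has the polynomial tail of \<open>\<nu>\<close>. A union bound over labels and Borel--Cantelli along integer
  times conclude.

  Lower bound: a newborn particle above level \<open>exp l\<close>, \<open>l = 2 ^ j\<close>, reproduces at rate at least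
  \<open>l powr \<gamma>\<close>. Keep only the descendants of generation \<open>n\<close> that are born within \<open>n\<close> units of clock
  time; their mean number \<open>n ^ n / fact n\<close> is of order \<open>exp n\<close>, so the Galton--Watson process of these
  blocks has almost the full growth rate. About \<open>2 * l * D * \<alpha>\<close> units of clock time yield
  \<open>exp (2 * l * D * \<alpha>)\<close> newborn particles, one of which jumps above \<open>exp (2 * l)\<close> and has a child there
  with a probability bounded below. Since only newborn particles are used and they carry fresh
  randomness, the stages can be chained without any Markov property; the children of the initial
  particle provide infinitely many independent attempts.
\<close>

section \<open>Pathwise properties of the particle system\<close>

text \<open>The integrated rate is continuous, vanishes at 0 and grows with slope at least 1, so it
  takes the value \<open>c\<close> exactly once and the set under the infimum is a singleton.
  Integrability matters because the set integral defaults to 0 otherwise.\<close>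

lemma ringing_time:
  fixes f :: "real \<Rightarrow> real"
  assumes mono: "mono_on {\<sigma>..} f" and ge: "\<And>s. s \<ge> \<sigma> \<Longrightarrow> f s \<ge> 1" and c: "c > 0"
  defines "h \<equiv> Inf {h. h > 0 \<and> (LBINT s:{\<sigma>..\<sigma> + h}. f s) = c}"
  shows "h > 0" and "(LBINT s:{\<sigma>..\<sigma> + h}. f s) = c"
    and "\<And>b. set_integrable lborel {\<sigma>..b} f"
proof -
  \<comment> \<open>Freezing \<open>f\<close> to the left of \<sigma> makes it monotone on the whole
    line, hence Borel measurable.\<close>
  define g where "g = (\<lambda>s. f (max s \<sigma>))"
  have "mono g"
    unfolding g_def mono_def by (auto intro!: mono_onD[OF mono])
  then have [measurable]: "g \<in> borel_measurable borel"
    by (rule borel_measurable_mono)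
  have int_g: "set_integrable lborel {\<sigma>..b} g" for b
    unfolding set_integrable_def
  proof (rule integrableI_bounded_set_indicator[where B="\<bar>g b\<bar>"])
    show "AE x in lborel. x \<in> {\<sigma>..b} \<longrightarrow> norm (g x) \<le> \<bar>g b\<bar>"
    proof (intro AE_I2 impI)
      fix s assume s: "s \<in> {\<sigma>..b}"
      have "g s \<le> g b" using \<open>mono g\<close> s by (auto simp: mono_def)
      moreover have "g s \<ge> 1" using s ge by (auto simp: g_def)
      ultimately show "norm (g s) \<le> \<bar>g b\<bar>" by auto
    qed
  qed (auto simp: emeasure_lborel_Icc_eq)
  have int_cong: "set_integrable lborel {\<sigma>..b} f \<longleftrightarrow> set_integrable lborel {\<sigma>..b} g" for b
    by (rule set_integrable_cong) (auto simp: g_def max_def)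
  then show int_f: "set_integrable lborel {\<sigma>..b} f" for b
    using int_g by blast
  define F where "F = (\<lambda>u. LBINT s:{\<sigma>..\<sigma> + u}. f s)"
  have F_eq: "F u = integral {\<sigma>..\<sigma> + u} f" for u
    unfolding F_def by (rule set_borel_integral_eq_integral(2)[OF int_f])
  have F_lower: "F v - F u \<ge> v - u" if "0 \<le> u" "u \<le> v" for u v
  proof -
    have i: "f integrable_on {\<sigma>..b}" for b
      using set_borel_integral_eq_integral(1)[OF int_f] .
    have "F v = F u + integral {\<sigma> + u..\<sigma> + v} f"
      unfolding F_eq using that
      by (intro Henstock_Kurzweil_Integration.integral_combine[symmetric] i) auto
    moreover have "integral {\<sigma> + u..\<sigma> + v} (\<lambda>_. 1) \<le> integral {\<sigma> + u..\<sigma> + v} f"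
    proof (rule Henstock_Kurzweil_Integration.integral_le)
      show "f integrable_on {\<sigma> + u..\<sigma> + v}"
        by (rule integrable_on_subinterval[OF i[of "\<sigma> + v"]]) (use that in auto)
    qed (use ge that in auto)
    ultimately show ?thesis using that by simp
  qed
  have F0: "F 0 = 0" unfolding F_eq by simp
  have cont: "continuous_on {0..c} F"
  proof -
    have "continuous_on {\<sigma>..\<sigma> + c} (\<lambda>b. integral {\<sigma>..b} f)"
      by (rule indefinite_integral_continuous_1)
        (rule set_borel_integral_eq_integral(1)[OF int_f])
    then have "continuous_on {0..c} (\<lambda>u. integral {\<sigma>..\<sigma> + u} f)"
      by (rule continuous_on_compose2[where f="\<lambda>u. \<sigma> + u"]) (auto intro!: continuous_intros)
    then show ?thesis by (simp add: F_eq)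
  qed
  obtain u where u: "0 \<le> u" "u \<le> c" "F u = c"
  proof -
    have "F 0 \<le> c" "c \<le> F c" using F0 F_lower[of 0 c] c by simp_all
    from IVT'[OF this less_imp_le[OF c] cont] show thesis using that by blast
  qed
  have u_pos: "u > 0" using u F0 c by (cases "u = 0") auto
  have unique: "v = u" if "v > 0" "F v = c" for v
    using F_lower[of v u] F_lower[of u v] that u u_pos by linarith
  have "{h. h > 0 \<and> (LBINT s:{\<sigma>..\<sigma> + h}. f s) = c} = {u}"
    using unique[unfolded F_def] u[unfolded F_def] u_pos by blast
  then have "h = u" unfolding h_def by simp
  then show "h > 0" "(LBINT s:{\<sigma>..\<sigma> + h}. f s) = c"
    using u_pos u(3)[unfolded F_def] by simp_all
qed

lemma set_integral_Icc_const:
  fixes k :: real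
  shows "set_integrable lborel {a..b} (\<lambda>s. k)"
    and "a \<le> b \<Longrightarrow> (LBINT s:{a..b}. k) = k * (b - a)"
proof -
  show i: "set_integrable lborel {a..b} (\<lambda>s. k)"
    by (rule borel_integrable_atLeastAtMost') simp
  show "(LBINT s:{a..b}. k) = k * (b - a)" if "a \<le> b"
    using set_borel_integral_eq_integral(2)[OF i] that by simp
qed

declare particle.simps(2) [simp del] branching_time.simps(2) [simp del]

section \<open>Trajectories and birth times for a fixed outcome\<close>

locale realisation =
  fixes \<gamma> :: real and n :: "label \<Rightarrow> real \<Rightarrow> nat" and x c :: "label \<Rightarrow> nat \<Rightarrow> real"
  assumes gamma_pos: "0 < \<gamma>"
    and arrivals_0: "\<And>u. n u 0 = 0"
    and arrivals_mono: "\<And>u. mono_on {0..} (n u)"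
    and jumps_nonneg: "\<And>u i. x u i \<ge> 0"
    and clocks_pos: "\<And>u k. c u k > 0"
begin

abbreviation "born u \<equiv> fst (particle \<gamma> n x c u)"
abbreviation "traj u \<equiv> snd (particle \<gamma> n x c u)"
abbreviation "jumped u \<equiv> compound_sum (n u) (x u)"
abbreviation "ring u \<equiv> branching_time \<gamma> (traj u) (born u) (c u)"

lemma jumped_0: "jumped u 0 = 0"
  by (simp add: compound_sum_def arrivals_0)

lemma jumped_mono: "0 \<le> s \<Longrightarrow> s \<le> t \<Longrightarrow> jumped u s \<le> jumped u t"
  unfolding compound_sum_def
  by (rule sum_mono2)
    (use mono_onD[OF arrivals_mono[of u], of s t] in \<open>auto simp: jumps_nonneg\<close>)

lemma born_Cons: "born (k # u) = ring u (Suc k)"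
  by (simp add: particle.simps(2) case_prod_beta Let_def)

lemma traj_Cons: "traj (k # u) t = traj u (born (k # u)) + jumped (k # u) (t - born (k # u))"
  by (simp add: particle.simps(2) case_prod_beta Let_def)

lemma traj_eq: "traj u t = traj u (born u) + jumped u (t - born u)"
proof (cases u)
  case Nil then show ?thesis using jumped_0[of "[]"] by simp
next
  case (Cons k v) then show ?thesis by (simp add: traj_Cons jumped_0)
qed

lemma traj_mono: "born u \<le> s \<Longrightarrow> s \<le> t \<Longrightarrow> traj u s \<le> traj u t"
  using traj_eq[of u s] traj_eq[of u t] jumped_mono[of "s - born u" "t - born u" u] by simp

text \<open>A path that starts above \<open>exp 1\<close> keeps its logarithm at least 1, which
  provides the hypotheses of \<open>ringing_time\<close>.\<close>

lemma rate_mono: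
  assumes "exp 1 \<le> traj u (born u)"
  shows "mono_on {born u..} (\<lambda>s. ln (traj u s) powr \<gamma>)"
    and "born u \<le> s \<Longrightarrow> 1 \<le> ln (traj u s) powr \<gamma>"
proof -
  have *: "1 \<le> ln (traj u s)" "0 < traj u s" if "born u \<le> s" for s
  proof -
    have le: "exp 1 \<le> traj u s" using assms traj_mono[of u "born u" s] that by simp
    then show "0 < traj u s" using exp_gt_zero less_le_trans by blast
    then show "1 \<le> ln (traj u s)" using le by (simp add: ln_ge_iff)
  qed
  show "mono_on {born u..} (\<lambda>s. ln (traj u s) powr \<gamma>)"
  proof (rule mono_onI)
    fix s t assume "s \<in> {born u..}" "t \<in> {born u..}" "s \<le> t"
    moreover from this have "ln (traj u s) \<le> ln (traj u t)"
      using *[of s] *[of t] traj_mono[of u s t] by simp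
    ultimately show "ln (traj u s) powr \<gamma> \<le> ln (traj u t) powr \<gamma>"
      using *(1)[of s] gamma_pos by (intro powr_mono2) auto
  qed
  show "1 \<le> ln (traj u s) powr \<gamma>" if "born u \<le> s"
    using *[OF that] gamma_pos by (intro ge_one_powr_ge_zero) auto
qed

text \<open>Each ring is the starting point for the next use of \<open>ringing_time\<close>. The
  hypothesis on the position at birth is discharged in \<open>traj_born_ge_e\<close>, by an
  induction that needs the present lemma only for the parent.\<close>

lemma ring_step:
  assumes "exp 1 \<le> traj u (born u)"
  shows "born u \<le> ring u k" and "ring u k < ring u (Suc k)"
    and "(LBINT s:{ring u k..ring u (Suc k)}. ln (traj u s) powr \<gamma>) = c u k"
    and "set_integrable lborel {ring u k..ring u (Suc k)} (\<lambda>s. ln (traj u s) powr \<gamma>)"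
proof -
  have step: "ring u k < ring u (Suc k) \<and>
      (LBINT s:{ring u k..ring u (Suc k)}. ln (traj u s) powr \<gamma>) = c u k \<and>
      set_integrable lborel {ring u k..ring u (Suc k)} (\<lambda>s. ln (traj u s) powr \<gamma>)"
    if "born u \<le> ring u k" for k
  proof -
    have m: "mono_on {ring u k..} (\<lambda>s. ln (traj u s) powr \<gamma>)"
      by (rule mono_on_subset[OF rate_mono(1)[OF assms]]) (use that in auto)
    show ?thesis
      using ringing_time[OF m _ clocks_pos[of u k]] rate_mono(2)[OF assms] that
      by (auto simp: Let_def branching_time.simps(2))
  qed
  show ge: "born u \<le> ring u k" for k
  proof (induction k)
    case 0 then show ?case by simp
  next
    case (Suc k) then show ?case using step[of k] by linarith
  qed
  show "ring u k < ring u (Suc k)"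
    and "(LBINT s:{ring u k..ring u (Suc k)}. ln (traj u s) powr \<gamma>) = c u k"
    and "set_integrable lborel {ring u k..ring u (Suc k)} (\<lambda>s. ln (traj u s) powr \<gamma>)"
    using step[OF ge[of k]] by auto
qed

lemma traj_born_ge_e: "exp 1 \<le> traj u (born u)"
proof (induction u)
  case Nil then show ?case using jumped_0[of "[]"] by simp
next
  case (Cons k u)
  have "born u \<le> born (k # u)" unfolding born_Cons by (rule ring_step(1)[OF Cons])
  then show ?case
    using traj_mono[of u "born u" "born (k # u)"] Cons
    by (simp add: traj_Cons jumped_0)
qed

lemmas ring_ge = ring_step(1)[OF traj_born_ge_e]
lemmas ring_less = ring_step(2)[OF traj_born_ge_e]
lemmas ring_integral = ring_step(3,4)[OF traj_born_ge_e]

lemma ring_mono: "i \<le> j \<Longrightarrow> ring u i \<le> ring u j"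
  by (rule lift_Suc_mono_le[where f="ring u", OF less_imp_le[OF ring_less]])

lemma born_Cons_ge: "born u \<le> born (k # u)"
  unfolding born_Cons by (rule ring_ge)

lemma traj_born_Cons: "traj (k # u) (born (k # u)) = traj u (born (k # u))"
  by (simp add: traj_Cons[of k u] jumped_0)

lemma traj_born_Cons_ge: "traj u (born u) \<le> traj (k # u) (born (k # u))"
  unfolding traj_born_Cons by (intro traj_mono born_Cons_ge order_refl)

lemma traj_ge_e: "born u \<le> s \<Longrightarrow> exp 1 \<le> traj u s"
  using traj_born_ge_e[of u] traj_mono[of u "born u" s] by simp

lemma traj_pos: "born u \<le> s \<Longrightarrow> 0 < traj u s"
  using traj_ge_e[of u s] exp_gt_zero[of 1] by linarith

text \<open>A clock is the integral of the rate and paths are nondecreasing, so a lower level at the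
  start of the waiting period bounds the rate throughout it.\<close>

lemma ring_step_le:
  assumes "1 \<le> l" "exp l \<le> traj u (ring u k)"
  shows "l powr \<gamma> * (ring u (Suc k) - ring u k) \<le> c u k"
proof -
  have "(LBINT s:{ring u k..ring u (Suc k)}. l powr \<gamma>)
      \<le> (LBINT s:{ring u k..ring u (Suc k)}. ln (traj u s) powr \<gamma>)"
  proof (rule set_integral_mono)
    show "set_integrable lborel {ring u k..ring u (Suc k)} (\<lambda>s. l powr \<gamma>)"
      by (rule set_integral_Icc_const)
    fix s assume s: "s \<in> {ring u k..ring u (Suc k)}"
    have "exp l \<le> traj u s"
      using assms s traj_mono[of u "ring u k" s] ring_ge[of u k] by simp
    then have "l \<le> ln (traj u s)"
      using traj_pos[of u s] s ring_ge[of u k] by (simp add: ln_ge_iff)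
    then show "l powr \<gamma> \<le> ln (traj u s) powr \<gamma>"
      using assms gamma_pos by (intro powr_mono2) auto
  qed (rule ring_integral)
  then show ?thesis
    using ring_less[of u k]
    by (simp add: ring_integral set_integral_Icc_const)
qed

text \<open>The reverse comparison; by monotonicity an upper level needs to be checked only at the
  end of the waiting period.\<close>

lemma ring_step_ge:
  assumes "1 \<le> l" "traj u (ring u (Suc k)) \<le> exp l"
  shows "c u k \<le> l powr \<gamma> * (ring u (Suc k) - ring u k)"
proof -
  have "(LBINT s:{ring u k..ring u (Suc k)}. ln (traj u s) powr \<gamma>)
      \<le> (LBINT s:{ring u k..ring u (Suc k)}. l powr \<gamma>)"
  proof (rule set_integral_mono)
    show "set_integrable lborel {ring u k..ring u (Suc k)} (\<lambda>s. l powr \<gamma>)"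
      by (rule set_integral_Icc_const)
    fix s assume s: "s \<in> {ring u k..ring u (Suc k)}"
    have b: "born u \<le> s" using s ring_ge[of u k] by simp
    have "traj u s \<le> exp l"
      using assms s traj_mono[of u s "ring u (Suc k)"] b by simp
    then have "ln (traj u s) \<le> l"
      using traj_pos[OF b] by (metis ln_exp ln_le_cancel_iff exp_gt_zero)
    moreover have "0 \<le> ln (traj u s)"
      using traj_ge_e[OF b] traj_pos[OF b] by (meson ln_ge_zero order_trans one_le_exp_iff zero_le_one)
    ultimately show "ln (traj u s) powr \<gamma> \<le> l powr \<gamma>"
      using gamma_pos by (intro powr_mono2) auto
  qed (rule ring_integral)
  then show ?thesis
    using ring_less[of u k]
    by (simp add: ring_integral set_integral_Icc_const)
qed

text \<open>Telescoping over the rings. The child \<open>k # u\<close> appears at ring number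
  \<open>Suc k\<close>, so the clocks with indices \<open>0\<close> to \<open>k\<close> have been
  spent.\<close>

lemma born_Cons_le:
  assumes "1 \<le> l" "exp l \<le> traj u (born u)"
  shows "l powr \<gamma> * (born (k # u) - born u) \<le> (\<Sum>i\<le>k. c u i)"
proof -
  have "l powr \<gamma> * (ring u m - born u) \<le> (\<Sum>i<m. c u i)" for m
  proof (induction m)
    case 0 then show ?case by simp
  next
    case (Suc m)
    have "exp l \<le> traj u (ring u m)"
      using assms traj_mono[of u "born u" "ring u m"] ring_ge[of u m] by simp
    from ring_step_le[OF assms(1) this] Suc show ?case
      by (simp add: algebra_simps)
  qed
  from this[of "Suc k"] show ?thesis unfolding born_Cons lessThan_Suc_atMost .
qed

lemma born_Cons_lower:
  assumes "1 \<le> l" "traj u (born (k # u)) \<le> exp l"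
  shows "(\<Sum>i\<le>k. c u i) \<le> l powr \<gamma> * (born (k # u) - born u)"
proof -
  have "(\<Sum>i<m. c u i) \<le> l powr \<gamma> * (ring u m - born u)" if "m \<le> Suc k" for m
    using that
  proof (induction m)
    case 0 then show ?case by simp
  next
    case (Suc m)
    have "ring u (Suc m) \<le> ring u (Suc k)"
      using Suc.prems by (intro ring_mono) simp
    then have "traj u (ring u (Suc m)) \<le> exp l"
      using assms traj_mono[of u "ring u (Suc m)" "ring u (Suc k)"] ring_ge[of u "Suc m"]
      unfolding born_Cons by linarith
    from ring_step_ge[OF assms(1) this] Suc show ?case
      by (simp add: algebra_simps)
  qed
  from this[of "Suc k"] show ?thesis unfolding born_Cons lessThan_Suc_atMost by simp
qed

text \<open>If the child were born before the jump, the parent would have spent its first clock, which is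
  at least 1, at a rate of at most \<open>(2l) powr \<gamma>\<close> during a time shorter than \<open>1 / (2l) powr \<gamma>\<close>.\<close>

lemma big_jump_first_child:
  assumes l: "1 \<le> l" "exp l \<le> traj u (born u)"
    and "n u (1 / (2 * l) powr \<gamma>) \<ge> 1" and "x u 0 > exp (2 * l) - exp l"
    and "1 \<le> c u 0" and "c u 0 \<le> 2"
  shows "exp (2 * l) \<le> traj (0 # u) (born (0 # u))"
    and "l powr \<gamma> * (born (0 # u) - born u) \<le> 2"
proof -
  show "l powr \<gamma> * (born (0 # u) - born u) \<le> 2"
    using born_Cons_le[OF l, of 0] assms(6) by simp
  let ?d = "born (0 # u) - born u"
  show "exp (2 * l) \<le> traj (0 # u) (born (0 # u))"
  proof (cases "1 / (2 * l) powr \<gamma> \<le> ?d")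
    case True
    have "n u (1 / (2 * l) powr \<gamma>) \<le> n u ?d"
      using True l by (intro mono_onD[OF arrivals_mono]) (auto simp: born_Cons_ge)
    then have "(\<Sum>i<1. x u i) \<le> jumped u ?d"
      unfolding compound_sum_def using assms(3) by (intro sum_mono2) (auto simp: jumps_nonneg)
    then show ?thesis
      unfolding traj_born_Cons traj_eq[of u "born (0 # u)"] using assms by simp
  next
    case False
    show ?thesis
    proof (rule ccontr)
      assume "\<not> ?thesis"
      then have "c u 0 \<le> (2 * l) powr \<gamma> * ?d"
        using born_Cons_lower[of "2 * l" u 0] l traj_born_Cons[of 0 u] by simp
      also have "\<dots> < (2 * l) powr \<gamma> * (1 / (2 * l) powr \<gamma>)"
        using False l by (intro mult_strict_left_mono) auto
      also have "\<dots> = 1" using l by simp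
      finally show False using assms by simp
    qed
  qed
qed

end

section \<open>Independence and the clock sums along a lineage\<close>

text \<open>The partial sums of the entries increased by one encode a label as an
  \<open>n\<close>-element subset of \<open>{1..J}\<close>. The induction removes the head and uses
  the hockey-stick identity.\<close>

lemma card_labels:
  fixes n J :: nat
  defines "A \<equiv> \<lambda>n J. {u :: label. length u = n \<and> sum_list (map Suc u) \<le> J}"
  shows "finite (A n J) \<and> card (A n J) = J choose n"
proof (induction n arbitrary: J)
  case 0
  have "A 0 J = {[]}" unfolding A_def by auto
  then show ?case by simp
next
  case (Suc n)
  have eq: "A (Suc n) J = (\<Union>k<J. (#) k ` A n (J - 1 - k))"
  proof (intro equalityI subsetI)
    fix u assume u: "u \<in> A (Suc n) J"
    then obtain k w where "u = k # w" by (cases u) (auto simp: A_def)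
    with u show "u \<in> (\<Union>k<J. (#) k ` A n (J - 1 - k))"
      by (auto simp: A_def intro!: bexI[of _ k])
  qed (auto simp: A_def)
  have "card (A (Suc n) J) = (\<Sum>k<J. card ((#) k ` A n (J - 1 - k)))"
    unfolding eq using Suc.IH by (intro card_UN_disjoint) auto
  also have "\<dots> = (\<Sum>k<J. (J - 1 - k) choose n)"
    using Suc.IH by (simp add: card_image)
  also have "\<dots> = (\<Sum>k<J. k choose n)"
    by (rule sum.reindex_bij_witness[of _ "\<lambda>k. J - 1 - k" "\<lambda>k. J - 1 - k"]) auto
  also have "\<dots> = J choose Suc n"
    by (cases J) (simp_all only: lessThan_0 sum.empty lessThan_Suc_atMost sum_choose_upper binomial_0_Suc)
  finally show ?case using Suc.IH unfolding eq by auto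
qed

text \<open>Up to the factor \<open>fact n\<close> this is a factorial moment: the terms with
  \<open>J < n\<close> vanish, and shifting the index by \<open>n\<close> leaves the exponential
  series.\<close>

lemma poisson_factorial_moment:
  assumes "0 < a"
  shows "(\<integral>\<^sup>+ J. ennreal (real (J choose n)) \<partial>measure_pmf (poisson_pmf a)) = ennreal (a ^ n / fact n)"
proof -
  let ?f = "\<lambda>J. a ^ J / fact J * exp (- a) * real (J choose n)"
  have "(\<lambda>i. a ^ i / fact i) sums exp a"
    using exp_converges[of a] by (simp add: field_simps)
  then have "(\<lambda>i. a ^ i / fact i * (exp (- a) * a ^ n / fact n)) sums (exp a * (exp (- a) * a ^ n / fact n))"
    by (rule sums_mult2)
  moreover have "a ^ i / fact i * (exp (- a) * a ^ n / fact n) = ?f (i + n)" for i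
    by (simp add: binomial_fact power_add field_simps)
  moreover have "exp a * (exp (- a) * a ^ n / fact n) = a ^ n / fact n"
    by (simp add: exp_minus)
  ultimately have "(\<lambda>i. ?f (i + n)) sums (a ^ n / fact n)"
    by (simp only:)
  then have "?f sums (a ^ n / fact n)"
    by (subst (asm) sums_zero_iff_shift) (auto simp: binomial_eq_0)
  then have "(\<Sum>J. ennreal (?f J)) = ennreal (a ^ n / fact n)"
    using assms by (intro suminf_ennreal_eq) auto
  then show ?thesis
    using assms
    by (simp add: nn_integral_measure_pmf nn_integral_count_space_nat ennreal_mult[symmetric] del: fact_Suc)
qed

text \<open>In a unit-rate Poisson process the \<open>m\<close>-th arrival comes by time
  \<open>a\<close> exactly when there are at least \<open>m\<close> arrivals by then.
  \<open>erlang_CDF k\<close> belongs to a sum of \<open>k + 1\<close> exponentials, hence the index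
  \<open>m - 1\<close>.\<close>

lemma erlang_CDF_eq_poisson_tail:
  assumes "0 < a" "1 \<le> m"
  shows "erlang_CDF (m - 1) 1 a = measure (poisson_pmf a) {m..}"
proof -
  have "measure (poisson_pmf a) {m..} = measure (poisson_pmf a) (UNIV - {..<m})"
    by (rule arg_cong2[where f=measure]) auto
  also have "\<dots> = 1 - measure (poisson_pmf a) {..<m}"
    using measure_pmf.prob_compl[of "{..<m}" "poisson_pmf a"] by simp
  also have "measure (poisson_pmf a) {..<m} = (\<Sum>j<m. a ^ j * exp (- a) / fact j)"
    using assms by (simp add: measure_measure_pmf_finite)
  also have "{..<m} = {..m - 1}" using assms by auto
  finally show ?thesis using assms by (simp add: erlang_CDF_def)
qed

text \<open>Labels grow at the head, so \<open>u @ v\<close> is the descendant of \<open>v\<close>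
  with relative label \<open>u\<close>. The clocks run down between these two births are recorded as
  a set of sources, in the form that independence statements use.\<close>

primrec lineage :: "label \<Rightarrow> label \<Rightarrow> source set" where
  "lineage v [] = {}"
| "lineage v (k # w) = lineage v w \<union> Clock (w @ v) ` {..k}"

text \<open>The strict inequality says that at the birth of \<open>u @ v\<close> no clock owned by
  its generation or a later one has been used.\<close>

lemma lineage_length: "Clock w i \<in> lineage v u \<Longrightarrow> length w < length u + length v"
  by (induction u) auto

lemma lineage_suffix: "s \<in> lineage v u \<Longrightarrow> \<exists>w i. s = Clock (w @ v) i"
  by (induction u) auto

lemma card_lineage: "finite (lineage v u) \<and> card (lineage v u) = sum_list (map Suc u)"
proof (induction u)
  case (Cons k w)
  have "lineage v w \<inter> Clock (w @ v) ` {..k} = {}"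
    using lineage_length[of "w @ v" _ v w] by auto
  then show ?case
    using Cons by (auto simp: card_Un_disjoint card_image inj_on_def)
qed simp

section \<open>Sigma-algebras generated by sets of sources, and the law of clock sums\<close>

context branching_randomness
begin

text \<open>Packaging the sigma-algebra as a measure space allows measurability to be stated
  relative to partial information.\<close>

definition info :: "source set \<Rightarrow> 'w measure" where
  "info S = sigma (space P) (\<Union>s\<in>S. source_events P N \<xi> \<E> s)"

lemma source_events_subset: "source_events P N \<xi> \<E> s \<subseteq> events"
  using independent unfolding indep_sets_def by blast

lemma source_events_Pow: "source_events P N \<xi> \<E> s \<subseteq> Pow (space P)"
  using source_events_subset[of s] sets.space_closed by blast

text \<open>The pi-system property that lets independence pass from single sources to the
  sigma-algebras of blocks of sources.\<close>

lemma Int_stable_source_events: "Int_stable (source_events P N \<xi> \<E> s)"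
proof (cases s)
  case (Arrivals u)
  have "sigma_algebra (space P) (source_events P N \<xi> \<E> s)"
    unfolding Arrivals source_events.simps by (rule sigma_algebra_sigma_sets) auto
  then interpret sigma_algebra "space P" "source_events P N \<xi> \<E> s" .
  show ?thesis by (auto simp: Int_stable_def)
next
  case (Jump u i)
  show ?thesis unfolding Jump source_events.simps
    by (auto simp: Int_stable_def) (metis sets.Int vimage_Int inf_assoc inf_commute inf_left_idem)
next
  case (Clock u i)
  show ?thesis unfolding Clock source_events.simps
    by (auto simp: Int_stable_def) (metis sets.Int vimage_Int inf_assoc inf_commute inf_left_idem)
qed

lemma space_info [simp]: "space (info S) = space P"
  unfolding info_def using source_events_Pow by (intro space_measure_of) blast

lemma sets_info: "sets (info S) = sigma_sets (space P) (\<Union>s\<in>S. source_events P N \<xi> \<E> s)"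
  unfolding info_def using source_events_Pow by (intro sets_measure_of) blast

lemma sets_info_mono: "S \<subseteq> S' \<Longrightarrow> sets (info S) \<subseteq> sets (info S')"
  unfolding sets_info by (intro sigma_sets_mono' UN_mono) auto

lemma info_events: "A \<in> sets (info S) \<Longrightarrow> A \<in> events"
  unfolding sets_info using source_events_subset sets.sigma_sets_subset[of "\<Union>s\<in>S. source_events P N \<xi> \<E> s" P]
  by blast

text \<open>Disjoint blocks of independent sources generate independent sigma-algebras; a Boolean
  index names the two blocks.\<close>

lemma prob_indep:
  assumes "S \<inter> S' = {}" "A \<in> sets (info S)" "B \<in> sets (info S')"
  shows "prob (A \<inter> B) = prob A * prob B"
proof -
  let ?I = "\<lambda>b. if b then S else S'"
  have "indep_sets (\<lambda>b. sigma_sets (space P) (\<Union>s\<in>?I b. source_events P N \<xi> \<E> s)) UNIV"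
  proof (rule indep_sets_collect_sigma)
    show "indep_sets (source_events P N \<xi> \<E>) (\<Union>b\<in>UNIV. ?I b)"
      by (rule indep_sets_mono_index[OF _ independent]) simp
    show "disjoint_family_on ?I UNIV"
      using assms(1) by (auto simp: disjoint_family_on_def)
  qed (rule Int_stable_source_events)
  from indep_setsD[OF this, of UNIV "\<lambda>b. if b then A else B"] assms(2,3)
  show ?thesis by (simp add: sets_info UNIV_bool Int_commute mult.commute)
qed

lemma measurable_info_arrivals:
  assumes "0 \<le> t" "Arrivals u \<in> S"
  shows "N u t \<in> measurable (info S) (count_space UNIV)"
proof (rule measurableI)
  fix A :: "nat set"
  have "N u t -` A \<inter> space P \<in> source_events P N \<xi> \<E> (Arrivals u)"
    using assms(1) by auto
  then show "N u t -` A \<inter> space (info S) \<in> sets (info S)"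
    using assms(2) unfolding sets_info space_info by (intro sigma_sets.Basic) blast
qed simp

lemma measurable_info_jump:
  assumes "Jump u i \<in> S"
  shows "\<xi> u i \<in> borel_measurable (info S)"
proof (rule measurableI)
  fix A :: "real set" assume "A \<in> sets borel"
  then have "\<xi> u i -` A \<inter> space P \<in> source_events P N \<xi> \<E> (Jump u i)" by auto
  then show "\<xi> u i -` A \<inter> space (info S) \<in> sets (info S)"
    using assms unfolding sets_info space_info by (intro sigma_sets.Basic) blast
qed simp

lemma measurable_info_clock:
  assumes "Clock u i \<in> S"
  shows "\<E> u i \<in> borel_measurable (info S)"
proof (rule measurableI)
  fix A :: "real set" assume "A \<in> sets borel"
  then have "\<E> u i -` A \<inter> space P \<in> source_events P N \<xi> \<E> (Clock u i)" by auto
  then show "\<E> u i -` A \<inter> space (info S) \<in> sets (info S)"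
    using assms unfolding sets_info space_info by (intro sigma_sets.Basic) blast
qed simp

text \<open>Lets a clock sum be indexed by sources. The default 0 is never met in a
  \<open>lineage\<close>, which contains clocks only.\<close>

definition clock :: "source \<Rightarrow> 'w \<Rightarrow> real" where
  "clock s \<omega> = (case s of Clock u k \<Rightarrow> \<E> u k \<omega> | _ \<Rightarrow> 0)"

text \<open>The clock time between the births of \<open>v\<close> and \<open>u @ v\<close>; it
  becomes real time only after dividing by branching rates.\<close>

definition delay :: "label \<Rightarrow> label \<Rightarrow> 'w \<Rightarrow> real" where
  "delay v u \<omega> = (\<Sum>s\<in>lineage v u. clock s \<omega>)"

lemma delay_Nil: "delay v [] \<omega> = 0"
  by (simp add: delay_def)

lemma delay_Cons: "delay v (k # w) \<omega> = delay v w \<omega> + (\<Sum>i\<le>k. \<E> (w @ v) i \<omega>)"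
proof -
  have "lineage v w \<inter> Clock (w @ v) ` {..k} = {}"
    using lineage_length[of "w @ v" _ v w] by auto
  then show ?thesis
    using card_lineage[of v w]
    by (simp add: delay_def sum.union_disjoint sum.reindex inj_on_def clock_def)
qed

lemma measurable_delay: "lineage v u \<subseteq> S \<Longrightarrow> delay v u \<in> borel_measurable (info S)"
  unfolding delay_def
proof (rule borel_measurable_sum)
  fix s assume "lineage v u \<subseteq> S" "s \<in> lineage v u"
  with lineage_suffix[of s v u] obtain w i where "s = Clock (w @ v) i" "Clock (w @ v) i \<in> S" by auto
  then show "clock s \<in> borel_measurable (info S)"
    using measurable_info_clock[of "w @ v" i S] by (simp add: clock_def[abs_def])
qed

text \<open>The clocks of a lineage are distinct, hence independent, and their sum is Erlang
  distributed. The law depends on the relative label \<open>u\<close> only through the number of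
  clocks, and not on \<open>v\<close>.\<close>

lemma prob_delay:
  assumes "0 < a"
  shows "prob {\<omega> \<in> space P. delay v u \<omega> \<le> a} = measure (poisson_pmf a) {sum_list (map Suc u)..}"
\<comment> \<open>The Erlang law requires at least one summand, so the empty lineage is treated
  apart.\<close>
proof (cases "u = []")
  case True
  then show ?thesis using assms prob_space by (simp add: delay_Nil)
next
  case False
  let ?L = "lineage v u"
  have clocks_in: "\<exists>w i. s = Clock w i" if "s \<in> ?L" for s
    using lineage_suffix[OF that] by auto
  have m: "1 \<le> card ?L" unfolding card_lineage[THEN conjunct2] using False by (cases u) auto
  have "distributed P lborel (\<lambda>\<omega>. \<Sum>s\<in>?L. clock s \<omega>) (erlang_density (card ?L - 1) 1)"
  proof (rule exponential_distributed_sum)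
    show "finite ?L" "?L \<noteq> {}" using card_lineage[of v u] m by auto
    show d: "distributed P lborel (clock s) (exponential_density 1)" if "s \<in> ?L" for s
      using clocks_in[OF that] clocks by (auto simp: clock_def[abs_def])
    show "indep_vars (\<lambda>s. borel) clock ?L"
      unfolding indep_vars_def2
    proof
      show "\<forall>s\<in>?L. random_variable borel (clock s)"
        using d distributed_measurable by fastforce
      show "indep_sets (\<lambda>s. {clock s -` A \<inter> space P |A. A \<in> sets borel}) ?L"
      proof (rule indep_sets_mono[OF independent])
        fix s assume "s \<in> ?L"
        with clocks_in obtain w i where "s = Clock w i" by blast
        then show "{clock s -` A \<inter> space P |A. A \<in> sets borel} \<subseteq> source_events P N \<xi> \<E> s"
          by (auto simp: clock_def[abs_def])
      qed simp
    qed
  qed simp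
  from erlang_distributed_le[OF this, of a] assms
  have "prob {\<omega> \<in> space P. delay v u \<omega> \<le> a} = erlang_CDF (card ?L - 1) 1 a"
    by (simp add: delay_def)
  also have "\<dots> = measure (poisson_pmf a) {card ?L..}"
    by (rule erlang_CDF_eq_poisson_tail[OF assms m])
  finally show ?thesis by (simp add: card_lineage)
qed

text \<open>A label contributes \<open>1\<close> for every value of a Poisson variable \<open>J\<close> that is at least its
  number of clocks, so the sum over generation \<open>n\<close> is the expectation of \<open>J choose n\<close>.\<close>

lemma sum_prob_delay:
  assumes "0 < a"
  shows "(\<integral>\<^sup>+ u. ennreal (prob {\<omega> \<in> space P. delay v u \<omega> \<le> a}) \<partial>count_space {u. length u = n})
    = ennreal (a ^ n / fact n)"
proof -
  let ?A = "{u :: label. length u = n}" and ?p = "measure_pmf (poisson_pmf a)"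
  let ?m = "\<lambda>u :: label. sum_list (map Suc u)"
  have "(\<integral>\<^sup>+ u. ennreal (prob {\<omega> \<in> space P. delay v u \<omega> \<le> a}) \<partial>count_space ?A)
      = (\<integral>\<^sup>+ u. (\<integral>\<^sup>+ J. indicator {?m u..} J \<partial>?p) \<partial>count_space ?A)"
    by (simp add: prob_delay[OF assms] measure_pmf.emeasure_eq_measure)
  also have "\<dots> = (\<integral>\<^sup>+ J. (\<integral>\<^sup>+ u. indicator {?m u..} J \<partial>count_space ?A) \<partial>?p)"
    by (rule nn_integral_count_space_nn_integral[symmetric]) auto
  also have "\<dots> = (\<integral>\<^sup>+ J. ennreal (real (J choose n)) \<partial>?p)"
  proof (rule nn_integral_cong)
    fix J
    have "(\<integral>\<^sup>+ u. indicator {?m u..} J \<partial>count_space ?A)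
        = (\<integral>\<^sup>+ u. indicator {u. length u = n \<and> ?m u \<le> J} u \<partial>count_space ?A)"
      by (intro nn_integral_cong) (auto simp: indicator_def)
    also have "\<dots> = emeasure (count_space ?A) {u. length u = n \<and> ?m u \<le> J}"
      by (rule nn_integral_indicator) auto
    also have "\<dots> = of_nat (card {u. length u = n \<and> ?m u \<le> J})"
      using card_labels[of n J] by (intro emeasure_count_space_finite) auto
    also have "\<dots> = ennreal (real (J choose n))"
      using card_labels[of n J] by (simp add: ennreal_of_nat_eq_real_of_nat)
    finally show "(\<integral>\<^sup>+ u. indicator {?m u..} J \<partial>count_space ?A) = ennreal (real (J choose n))" .
  qed
  also have "\<dots> = ennreal (a ^ n / fact n)"
    by (rule poisson_factorial_moment[OF assms])
  finally show ?thesis .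
qed

end

section \<open>The first-moment bound\<close>

text \<open>Distributing a large total over \<open>n\<close> summands costs a polynomial factor; a
  geometric factor with ratio close to 1 absorbs it.\<close>

lemma power_le_geometric:
  fixes q \<theta> :: real
  assumes "1 < \<theta>"
  obtains K where "K > 0" "\<And>n :: nat. real n powr q \<le> K * \<theta> ^ n"
proof -
  have "(\<lambda>n :: nat. real n powr q / \<theta> ^ n) \<longlonglongrightarrow> 0"
    using assms by real_asymp
  then have "Bseq (\<lambda>n :: nat. real n powr q / \<theta> ^ n)"
    by (intro convergent_imp_Bseq convergentI)
  then obtain K where K: "K > 0" "\<And>n. norm (real n powr q / \<theta> ^ n) \<le> K"
    by (auto elim: BseqE)
  then have "real n powr q \<le> K * \<theta> ^ n" for n
    using K(2)[of n] assms by (simp add: divide_le_eq abs_mult)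
  then show thesis using that K(1) by blast
qed

primrec ancestors :: "label \<Rightarrow> label set" where
  "ancestors [] = {[]}"
| "ancestors (k # u) = insert (k # u) (ancestors u)"

lemma length_ancestors: "w \<in> ancestors u \<Longrightarrow> length w \<le> length u"
  by (induction u) auto

lemma card_ancestors: "finite (ancestors u) \<and> ancestors u \<noteq> {} \<and> card (ancestors u) = Suc (length u)"
proof (induction u)
  case (Cons k u)
  have "k # u \<notin> ancestors u" using length_ancestors by force
  then show ?case using Cons by simp
qed simp

lemma sum_ge_imp_ex_ge:
  fixes f :: "'b \<Rightarrow> real"
  assumes "finite I" "I \<noteq> {}" "real (card I) * z \<le> sum f I"
  shows "\<exists>i\<in>I. z \<le> f i"
proof (rule ccontr)
  assume "\<not> ?thesis"
  then have "sum f I < (\<Sum>i\<in>I. z)"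
    using assms by (intro sum_strict_mono) auto
  then show False using assms by simp
qed

context branching_randomness
begin

definition jumped_by :: "real \<Rightarrow> label \<Rightarrow> 'w \<Rightarrow> real" where
  "jumped_by t u \<omega> = compound_sum (\<lambda>s. N u s \<omega>) (\<lambda>i. \<xi> u i \<omega>) t"

text \<open>A bound for the position that avoids all birth times: every ancestor's compound sum is
  run for the full time \<open>t\<close>. This removes any dependence on the clocks.\<close>

definition reach :: "real \<Rightarrow> label \<Rightarrow> 'w \<Rightarrow> real" where
  "reach t u \<omega> = exp 1 + (\<Sum>w\<in>ancestors u. jumped_by t w \<omega>)"

lemma measurable_jumped_by:
  assumes "0 \<le> t" "Arrivals u \<in> S" "\<And>i. Jump u i \<in> S"
  shows "jumped_by t u \<in> borel_measurable (info S)"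
proof -
  have "(\<lambda>\<omega>. \<Sum>i<N u t \<omega>. \<xi> u i \<omega>) \<in> borel_measurable (info S)"
    by (rule measurable_compose_countable[OF _ measurable_info_arrivals[OF assms(1,2)]])
      (intro borel_measurable_sum measurable_info_jump assms)
  then show ?thesis by (simp add: jumped_by_def[abs_def] compound_sum_def)
qed

text \<open>Only arrivals and jumps enter, so \<open>reach\<close> is independent of every
  \<open>delay\<close>.\<close>

lemma measurable_reach:
  assumes "0 \<le> t"
  shows "reach t u \<in> borel_measurable (info (- range (case_prod Clock)))"
  unfolding reach_def[abs_def]
  by (intro borel_measurable_add borel_measurable_const borel_measurable_sum measurable_jumped_by assms)
    auto

lemma N_0: "\<omega> \<in> space P \<Longrightarrow> N u 0 \<omega> = 0"
  using arrivals[of u] by (simp add: poisson_process_def)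

lemma prob_arrivals:
  assumes "0 < t"
  shows "prob {\<omega> \<in> space P. N u t \<omega> \<in> A} = measure (poisson_pmf (rate * t)) A"
proof -
  have m: "N u t \<in> measurable P (count_space UNIV)"
    using arrivals[of u] assms by (simp add: poisson_process_def)
  have "distr P (count_space UNIV) (N u t) = distr P (count_space UNIV) (\<lambda>\<omega>. N u t \<omega> - N u 0 \<omega>)"
    by (rule distr_cong) (auto simp: N_0)
  also have "\<dots> = measure_pmf (poisson_pmf (rate * (t - 0)))"
    using arrivals[of u] assms unfolding poisson_process_def by blast
  finally have "measure (poisson_pmf (rate * t)) A = measure (distr P (count_space UNIV) (N u t)) A"
    by simp
  also have "\<dots> = prob {\<omega> \<in> space P. N u t \<omega> \<in> A}"
    by (subst measure_distr[OF m]) (auto intro!: arg_cong[where f=prob])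
  finally show ?thesis by simp
qed

lemma prob_jump: "A \<in> sets borel \<Longrightarrow> prob {\<omega> \<in> space P. \<xi> u i \<omega> \<in> A} = measure \<nu> A"
  using measure_distr[OF jumps_measurable[of u i], of A]
  by (simp add: jumps vimage_def Int_def conj_commute)

text \<open>Given \<open>j\<close> jumps, one of them must be at least \<open>z / j\<close>. The
  union bound gives the factor \<open>j powr (p + 1)\<close>, dominated by \<open>K * 2 ^ j\<close>,
  and the mean of \<open>2 ^ j\<close> under the Poisson law with parameter \<open>rate * t\<close>
  is \<open>exp (rate * t)\<close>.\<close>

lemma prob_jumped_by_ge:
  assumes rate: "0 < rate" and p: "0 < p" and C: "0 < C"
    and tail: "\<And>x. 0 < x \<Longrightarrow> measure \<nu> {x..} \<le> C * x powr - p"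
  obtains B where "0 < B"
    "\<And>t z u. 0 < t \<Longrightarrow> 0 < z \<Longrightarrow>
      prob {\<omega> \<in> space P. z \<le> jumped_by t u \<omega>} \<le> B * exp (rate * t) * z powr - p"
proof -
  obtain K where K: "K > 0" "\<And>j :: nat. real j powr (p + 1) \<le> K * 2 ^ j"
    using power_le_geometric[of 2 "p + 1"] by auto
  have "prob {\<omega> \<in> space P. z \<le> jumped_by t u \<omega>} \<le> (C * K) * exp (rate * t) * z powr - p"
    if t: "0 < t" and z: "0 < z" for t z u
  proof -
    let ?N = "\<lambda>j. {\<omega> \<in> space P. N u t \<omega> \<in> {j}}"
    let ?J = "\<lambda>j. \<Union>i<j. {\<omega> \<in> space P. \<xi> u i \<omega> \<in> {z / real j..}}"
    let ?pois = "\<lambda>j. (rate * t) ^ j / fact j * exp (- (rate * t))"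
    have N: "?N j \<in> sets (info {Arrivals u})" for j
      using measurable_sets[OF measurable_info_arrivals[of t u "{Arrivals u}"], of "{j}"] t
      by (simp add: vimage_def Int_def conj_commute)
    have J1: "{\<omega> \<in> space P. \<xi> u i \<omega> \<in> {x..}} \<in> sets (info (range (Jump u)))" for i x
      using measurable_sets[OF measurable_info_jump[of u i "range (Jump u)"], of "{x..}"]
      by (simp add: vimage_def Int_def conj_commute)
    then have J: "?J j \<in> sets (info (range (Jump u)))" for j by blast
    have ev: "?N j \<inter> ?J j \<in> events" for j
      using info_events[OF N[of j]] info_events[OF J[of j]] by blast
    have "{\<omega> \<in> space P. z \<le> jumped_by t u \<omega>} \<subseteq> (\<Union>j. ?N j \<inter> ?J j)"
    proof
      fix \<omega> assume \<omega>: "\<omega> \<in> {\<omega> \<in> space P. z \<le> jumped_by t u \<omega>}"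
      let ?n = "N u t \<omega>"
      have le: "z \<le> (\<Sum>i<?n. \<xi> u i \<omega>)" using \<omega> by (simp add: jumped_by_def compound_sum_def)
      then have "?n \<noteq> 0" using z by (intro notI) simp
      then have "\<exists>i\<in>{..<?n}. z / real ?n \<le> \<xi> u i \<omega>"
        using le by (intro sum_ge_imp_ex_ge) auto
      then have "\<omega> \<in> ?N ?n \<inter> ?J ?n" using \<omega> by auto
      then show "\<omega> \<in> (\<Union>j. ?N j \<inter> ?J j)" by blast
    qed
    then have "emeasure P {\<omega> \<in> space P. z \<le> jumped_by t u \<omega>} \<le> emeasure P (\<Union>j. ?N j \<inter> ?J j)"
      using ev by (intro emeasure_mono) auto
    also have "\<dots> \<le> (\<Sum>j. emeasure P (?N j \<inter> ?J j))"
      using ev by (intro emeasure_subadditive_countably) auto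
    also have "\<dots> \<le> (\<Sum>j. ennreal (?pois j * 2 ^ j * (C * K * z powr - p)))"
    proof (intro suminf_le allI)
      fix j :: nat
      have "prob (?J j) \<le> (\<Sum>i<j. prob {\<omega> \<in> space P. \<xi> u i \<omega> \<in> {z / real j..}})"
        using info_events[OF J1] by (intro finite_measure_subadditive_finite) auto
      also have "\<dots> = real j * measure \<nu> {z / real j..}"
        using prob_jump[of "{z / real j..}" u] by simp
      also have "\<dots> \<le> C * K * z powr - p * 2 ^ j"
      proof (cases "j = 0")
        case False
        have "real j * measure \<nu> {z / real j..} \<le> real j * (C * (z / real j) powr - p)"
          using False z by (intro mult_left_mono tail) auto
        also have "\<dots> = C * z powr - p * (real j powr (p + 1))"
          using False z by (simp add: powr_divide powr_minus powr_add field_simps)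
        also have "\<dots> \<le> C * z powr - p * (K * 2 ^ j)"
          using K C by (intro mult_left_mono) auto
        finally show ?thesis by (simp add: mult_ac)
      qed (use C K in simp)
      finally have J_le: "prob (?J j) \<le> C * K * z powr - p * 2 ^ j" .
      have "prob (?N j) = ?pois j"
        using rate t by (subst prob_arrivals[OF t]) (simp add: measure_pmf_single)
      then have "prob (?N j \<inter> ?J j) = ?pois j * prob (?J j)"
        using prob_indep[OF _ N[of j] J[of j]] by auto
      also have "\<dots> \<le> ?pois j * (C * K * z powr - p * 2 ^ j)"
        using J_le rate t by (intro mult_left_mono) auto
      finally show "emeasure P (?N j \<inter> ?J j) \<le> ennreal (?pois j * 2 ^ j * (C * K * z powr - p))"
        by (simp add: emeasure_eq_measure ennreal_leI mult_ac)
    qed auto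
    also have "\<dots> = ennreal (exp (rate * t) * (C * K * z powr - p))"
    proof (rule suminf_ennreal_eq)
      have "(\<lambda>j. (2 * (rate * t)) ^ j / fact j) sums exp (2 * (rate * t))"
        using exp_converges[of "2 * (rate * t)"] by (simp add: field_simps)
      from sums_mult2[OF this, of "exp (- (rate * t)) * (C * K * z powr - p)"]
      have "(\<lambda>j. ?pois j * 2 ^ j * (C * K * z powr - p))
          sums (exp (2 * (rate * t)) * exp (- (rate * t)) * (C * K * z powr - p))"
        by (simp add: power_mult_distrib mult_ac)
      then show "(\<lambda>j. ?pois j * 2 ^ j * (C * K * z powr - p)) sums (exp (rate * t) * (C * K * z powr - p))"
        by (simp add: exp_add[symmetric])
    qed (use C K rate t in auto)
    finally show ?thesis
      using C K by (simp add: emeasure_eq_measure mult_ac)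
  qed
  then show thesis using that[of "C * K"] C K by auto
qed

definition bad :: "real \<Rightarrow> real \<Rightarrow> real \<Rightarrow> 'w set" where
  "bad a t y = {\<omega> \<in> space P. \<exists>u. delay [] u \<omega> \<le> a \<and> y \<le> reach t u \<omega>}"

lemma bad_events: "0 \<le> t \<Longrightarrow> bad a t y \<in> events"
  and delay_events: "{\<omega> \<in> space P. delay v u \<omega> \<le> a} \<in> sets (info (range (case_prod Clock)))"
  and reach_events: "0 \<le> t \<Longrightarrow> {\<omega> \<in> space P. y \<le> reach t u \<omega>} \<in> sets (info (- range (case_prod Clock)))"
proof -
  have "lineage v u \<subseteq> range (case_prod Clock)" for v u
    using lineage_suffix[of _ v u] by force
  from measurable_sets[OF measurable_delay[OF this], of "{..a}"]
  show d: "{\<omega> \<in> space P. delay v u \<omega> \<le> a} \<in> sets (info (range (case_prod Clock)))" for v u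
    by (simp add: vimage_def Int_def conj_commute)
  show r: "{\<omega> \<in> space P. y \<le> reach t u \<omega>} \<in> sets (info (- range (case_prod Clock)))" if "0 \<le> t" for u
    using measurable_sets[OF measurable_reach[OF that], of "{y..}"]
    by (simp add: vimage_def Int_def conj_commute)
  have "bad a t y = (\<Union>u. {\<omega> \<in> space P. delay [] u \<omega> \<le> a} \<inter> {\<omega> \<in> space P. y \<le> reach t u \<omega>})"
    by (auto simp: bad_def)
  then show "bad a t y \<in> events" if "0 \<le> t"
    using info_events[OF d] info_events[OF r[OF that]] by auto
qed

text \<open>In generation \<open>n\<close>, one of the \<open>n + 1\<close> compound sums must carry
  its share of \<open>y - exp 1\<close>; this costs a polynomial factor, bounded by a multiple of
  \<open>\<theta> ^ n\<close>. By independence it multiplies the mean \<open>a ^ n / fact n\<close>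
  of the label count, and summing over \<open>n\<close> gives
  \<open>exp (\<theta> * a)\<close>.\<close>

lemma prob_bad:
  assumes rate: "0 < rate" and p: "0 < p" and C: "0 < C"
    and tail: "\<And>x. 0 < x \<Longrightarrow> measure \<nu> {x..} \<le> C * x powr - p"
    and \<theta>: "1 < \<theta>"
  obtains B where "0 < B"
    "\<And>a t y. 0 < a \<Longrightarrow> 0 < t \<Longrightarrow> exp 1 < y \<Longrightarrow>
      prob (bad a t y) \<le> B * exp (rate * t + \<theta> * a) * (y - exp 1) powr - p"
proof -
  obtain B where B: "0 < B" "\<And>t z u. 0 < t \<Longrightarrow> 0 < z \<Longrightarrow>
      prob {\<omega> \<in> space P. z \<le> jumped_by t u \<omega>} \<le> B * exp (rate * t) * z powr - p"
    by (rule prob_jumped_by_ge[OF rate p C]) (erule tail, rule that)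
  obtain K where K: "K > 0" "\<And>n :: nat. real n powr (p + 1) \<le> K * \<theta> ^ n"
    by (rule power_le_geometric[OF \<theta>, of "p + 1"]) (rule that)
  have "prob (bad a t y) \<le> (B * K * \<theta>) * exp (rate * t + \<theta> * a) * (y - exp 1) powr - p"
    if a: "0 < a" and t: "0 < t" and y: "exp 1 < y" for a t y
  proof -
    define Q where "Q = B * exp (rate * t) * (y - exp 1) powr - p"
    have Q: "0 \<le> Q" using B by (simp add: Q_def)
    let ?D = "\<lambda>u. {\<omega> \<in> space P. delay [] u \<omega> \<le> a}" and ?R = "\<lambda>u. {\<omega> \<in> space P. y \<le> reach t u \<omega>}"
    let ?bad = "\<lambda>n. \<Union>u\<in>{u. length u = n}. ?D u \<inter> ?R u"
    have t0: "0 \<le> t" using t by simp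
    have R_le: "prob (?R u) \<le> Q * K * \<theta> ^ Suc (length u)" for u
    proof -
      define m z where "m = real (card (ancestors u))" and "z = (y - exp 1) / m"
      have m_eq: "m = real (Suc (length u))" using card_ancestors[of u] by (simp add: m_def)
      then have m: "0 < m" by simp
      have z: "0 < z" using y m by (simp add: z_def)
      have ev: "{\<omega> \<in> space P. z \<le> jumped_by t w \<omega>} \<in> events" for w
        using info_events[OF measurable_sets[OF measurable_jumped_by[of t w UNIV], of "{z..}"]] t0
        by (simp add: vimage_def Int_def conj_commute)
      have "?R u \<subseteq> (\<Union>w\<in>ancestors u. {\<omega> \<in> space P. z \<le> jumped_by t w \<omega>})"
      proof
        fix \<omega> assume \<omega>: "\<omega> \<in> ?R u"
        have "m * z = y - exp 1" using m by (simp add: z_def)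
        then have "m * z \<le> (\<Sum>w\<in>ancestors u. jumped_by t w \<omega>)"
          using \<omega> by (simp add: reach_def)
        then have "\<exists>w\<in>ancestors u. z \<le> jumped_by t w \<omega>"
          using card_ancestors[of u] unfolding m_def by (intro sum_ge_imp_ex_ge) auto
        then show "\<omega> \<in> (\<Union>w\<in>ancestors u. {\<omega> \<in> space P. z \<le> jumped_by t w \<omega>})"
          using \<omega> by auto
      qed
      then have "prob (?R u) \<le> prob (\<Union>w\<in>ancestors u. {\<omega> \<in> space P. z \<le> jumped_by t w \<omega>})"
        using ev card_ancestors by (intro finite_measure_mono sets.finite_UN) auto
      also have "\<dots> \<le> (\<Sum>w\<in>ancestors u. prob {\<omega> \<in> space P. z \<le> jumped_by t w \<omega>})"
        using ev card_ancestors by (intro finite_measure_subadditive_finite) auto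
      also have "\<dots> \<le> (\<Sum>w\<in>ancestors u. B * exp (rate * t) * z powr - p)"
        by (intro sum_mono B t z)
      also have "\<dots> = m * (B * exp (rate * t) * z powr - p)"
        by (simp add: m_def)
      also have "z powr - p = (y - exp 1) powr - p * m powr p"
        using y m unfolding z_def by (subst powr_divide) (simp_all add: powr_minus_divide)
      also have "m * (B * exp (rate * t) * ((y - exp 1) powr - p * m powr p)) = Q * m powr (p + 1)"
        using m by (simp add: Q_def powr_add)
      also have "\<dots> \<le> Q * (K * \<theta> ^ Suc (length u))"
        unfolding m_eq by (intro mult_left_mono K Q)
      finally show ?thesis by (simp add: mult_ac)
    qed
    have bad_ev: "?D u \<inter> ?R u \<in> events" for u
      using info_events[OF delay_events] info_events[OF reach_events[OF t0]] by auto
    have "bad a t y = (\<Union>n. ?bad n)" by (auto simp: bad_def)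
    then have "emeasure P (bad a t y) \<le> (\<Sum>n. emeasure P (?bad n))"
      using bad_ev by (simp only:) (intro emeasure_subadditive_countably, auto)
    also have "\<dots> \<le> (\<Sum>n. ennreal ((a * \<theta>) ^ n / fact n * (Q * K * \<theta>)))"
    proof (intro suminf_le allI)
      fix n
      have "emeasure P (?bad n) = (\<integral>\<^sup>+ \<omega>. indicator (?bad n) \<omega> \<partial>P)"
        using bad_ev by (subst nn_integral_indicator) auto
      \<comment> \<open>The indicator of the union is at most the number of labels for which the
        event occurs, so the expected count is a bound.\<close>
      also have "\<dots> \<le> (\<integral>\<^sup>+ \<omega>. (\<integral>\<^sup>+ u. indicator (?D u \<inter> ?R u) \<omega> \<partial>count_space {u. length u = n}) \<partial>P)"
      proof (rule nn_integral_mono)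
        fix \<omega>
        show "indicator (?bad n) \<omega> \<le> (\<integral>\<^sup>+ u. indicator (?D u \<inter> ?R u) \<omega> \<partial>count_space {u. length u = n})"
        proof (cases "\<omega> \<in> ?bad n")
          case True
          then obtain u where u: "length u = n" "\<omega> \<in> ?D u \<inter> ?R u" by blast
          have "(1 :: ennreal) = indicator (?D u \<inter> ?R u) \<omega>" using u by simp
          also have "\<dots> \<le> (\<integral>\<^sup>+ u. indicator (?D u \<inter> ?R u) \<omega> \<partial>count_space {u. length u = n})"
            using u(1) by (intro nn_integral_ge_point) simp
          finally show ?thesis using True by (simp only: indicator_simps)
        qed simp
      qed
      also have "\<dots> = (\<integral>\<^sup>+ u. emeasure P (?D u \<inter> ?R u) \<partial>count_space {u. length u = n})"
        using bad_ev by (subst nn_integral_count_space_nn_integral) auto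
      also have "\<dots> \<le> (\<integral>\<^sup>+ u. ennreal (prob (?D u)) * ennreal (Q * K * \<theta> ^ Suc n) \<partial>count_space {u. length u = n})"
      proof (rule nn_integral_mono)
        fix u assume u: "u \<in> space (count_space {u :: label. length u = n})"
        have "prob (?D u \<inter> ?R u) = prob (?D u) * prob (?R u)"
          by (rule prob_indep[OF _ delay_events reach_events[OF t0]]) auto
        also have "\<dots> \<le> prob (?D u) * (Q * K * \<theta> ^ Suc n)"
          using R_le[of u] u by (intro mult_left_mono) auto
        finally show "emeasure P (?D u \<inter> ?R u) \<le> ennreal (prob (?D u)) * ennreal (Q * K * \<theta> ^ Suc n)"
          using Q K \<theta> by (simp add: emeasure_eq_measure ennreal_leI ennreal_mult[symmetric] del: power_Suc)
      qed
      also have "\<dots> = ennreal (a ^ n / fact n) * ennreal (Q * K * \<theta> ^ Suc n)"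
        by (subst nn_integral_multc) (simp_all add: sum_prob_delay[OF a])
      also have "\<dots> = ennreal ((a * \<theta>) ^ n / fact n * (Q * K * \<theta>))"
        using a Q K \<theta> by (subst ennreal_mult[symmetric]) (auto simp: power_mult_distrib mult_ac)
      finally show "emeasure P (?bad n) \<le> ennreal ((a * \<theta>) ^ n / fact n * (Q * K * \<theta>))" .
    qed auto
    also have "\<dots> = ennreal (exp (a * \<theta>) * (Q * K * \<theta>))"
    proof (rule suminf_ennreal_eq)
      show "(\<lambda>n. (a * \<theta>) ^ n / fact n * (Q * K * \<theta>)) sums (exp (a * \<theta>) * (Q * K * \<theta>))"
        using exp_converges[of "a * \<theta>"] by (intro sums_mult2) (simp add: field_simps)
    qed (use a Q K \<theta> in auto)
    finally have "prob (bad a t y) \<le> exp (a * \<theta>) * (Q * K * \<theta>)"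
      using Q K \<theta> by (subst (asm) emeasure_eq_measure, subst (asm) ennreal_le_iff) auto
    then show ?thesis by (simp add: Q_def exp_add mult_ac)
  qed
  then show thesis using that[of "B * K * \<theta>"] B K \<theta> by auto
qed

end

section \<open>Upper bound\<close>

text \<open>Along powers of \<open>exp 1\<close> slow variation makes the factors \<open>L\<close>
  cancel in the limit, leaving only the power \<open>- \<alpha>\<close>.\<close>

lemma tail_ratio:
  fixes \<alpha> :: real
  assumes "prob_space \<nu>" "slowly_varying L"
    and lim: "((\<lambda>x. measure \<nu> {x..} / (x powr (- \<alpha>) * L x)) \<longlongrightarrow> 1) at_top"
  shows "(\<lambda>m :: nat. measure \<nu> {exp (real (Suc m))..} / measure \<nu> {exp (real m)..}) \<longlonglongrightarrow> exp (- \<alpha>)"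
    and "\<forall>\<^sub>F m in sequentially. 0 < measure \<nu> {exp (real m)..}"
proof -
  define f where "f = (\<lambda>x. measure \<nu> {x..} / (x powr (- \<alpha>) * L x))"
  have Lpos: "0 < L x" if "0 < x" for x
    using assms(2) that by (simp add: slowly_varying_def)
  have e: "filterlim (\<lambda>m :: nat. exp (real m)) at_top sequentially"
    by real_asymp
  have f1: "(\<lambda>m :: nat. f (exp (real m))) \<longlonglongrightarrow> 1"
    using filterlim_compose[OF lim e] by (simp add: f_def)
  have "(\<lambda>m :: nat. f (exp (real (Suc m))) / f (exp (real m))) \<longlonglongrightarrow> 1 / 1"
    using f1 by (intro tendsto_divide LIMSEQ_Suc) auto
  moreover have "(\<lambda>m :: nat. L (exp 1 * exp (real m)) / L (exp (real m))) \<longlonglongrightarrow> 1"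
    using assms(2) by (intro filterlim_compose[OF _ e]) (auto simp: slowly_varying_def)
  ultimately have "(\<lambda>m. f (exp (real (Suc m))) / f (exp (real m)) *
      (exp (- \<alpha>) * (L (exp 1 * exp (real m)) / L (exp (real m))))) \<longlonglongrightarrow> 1 / 1 * (exp (- \<alpha>) * 1)"
    by (intro tendsto_mult tendsto_const)
  moreover have "f (exp (real (Suc m))) / f (exp (real m)) *
      (exp (- \<alpha>) * (L (exp 1 * exp (real m)) / L (exp (real m))))
      = measure \<nu> {exp (real (Suc m))..} / measure \<nu> {exp (real m)..}" for m
  proof -
    have e1: "exp (real (Suc m)) = exp 1 * exp (real m)" by (simp add: exp_add[symmetric])
    have p: "exp (real (Suc m)) powr (- \<alpha>) = exp (- \<alpha>) * exp (real m) powr (- \<alpha>)"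
      by (simp add: powr_def exp_add[symmetric] algebra_simps)
    show ?thesis
      unfolding f_def p unfolding e1
      using Lpos[of "exp (real m)"] Lpos[of "exp 1 * exp (real m)"]
      by (simp add: field_simps)
  qed
  ultimately show "(\<lambda>m :: nat. measure \<nu> {exp (real (Suc m))..} / measure \<nu> {exp (real m)..}) \<longlonglongrightarrow> exp (- \<alpha>)"
    by simp
  have "\<forall>\<^sub>F m in sequentially. 0 < f (exp (real m))"
    by (rule order_tendstoD(1)[OF f1]) simp
  then show "\<forall>\<^sub>F m in sequentially. 0 < measure \<nu> {exp (real m)..}"
  proof eventually_elim
    case (elim m)
    then show ?case
      using Lpos[of "exp (real m)"] by (auto simp: f_def zero_less_divide_iff less_le)
  qed
qed

text \<open>A Potter-type bound: consecutive tails at \<open>exp m\<close> eventually shrink by more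
  than \<open>exp (- p)\<close>, and this is iterated. Small arguments use the trivial bound
  1.\<close>

lemma tail_upper_bound:
  fixes \<alpha> :: real
  assumes "prob_space \<nu>" "sets \<nu> = sets borel" "slowly_varying L"
    and lim: "((\<lambda>x. measure \<nu> {x..} / (x powr (- \<alpha>) * L x)) \<longlongrightarrow> 1) at_top"
    and p: "0 < p" "p < \<alpha>"
  obtains C where "0 < C" "\<And>x. 0 < x \<Longrightarrow> measure \<nu> {x..} \<le> C * x powr - p"
proof -
  interpret nu: prob_space \<nu> by fact
  define h where "h = (\<lambda>m :: nat. measure \<nu> {exp (real m)..})"
  have "\<forall>\<^sub>F m in sequentially. h (Suc m) / h m < exp (- p)"
    unfolding h_def by (rule order_tendstoD(2)[OF tail_ratio(1)[OF assms(1,3) lim]]) (use p in simp)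
  with tail_ratio(2)[OF assms(1,3) lim]
  have "\<forall>\<^sub>F m in sequentially. h (Suc m) \<le> exp (- p) * h m"
    by eventually_elim (simp add: h_def field_simps)
  then obtain m0 where m0: "\<And>m. m0 \<le> m \<Longrightarrow> h (Suc m) \<le> exp (- p) * h m"
    by (auto simp: eventually_sequentially)
  have h: "h m \<le> exp (- p * (real m - real m0))" if "m0 \<le> m" for m
    using that
  proof (induction m rule: dec_induct)
    case base then show ?case by (simp add: h_def)
  next
    case (step m)
    have "h (Suc m) \<le> exp (- p) * exp (- p * (real m - real m0))"
      using m0[of m] step by (intro order_trans[OF m0]) auto
    then show ?case by (simp add: exp_add[symmetric] algebra_simps)
  qed
  \<comment> \<open>The summand 1 in the constant pays for rounding \<open>ln x\<close> down to an
    integer.\<close>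
  have "measure \<nu> {x..} \<le> exp (p * (real m0 + 1)) * x powr - p" if x: "0 < x" for x
  proof (cases "ln x \<le> real m0")
    case True
    have "measure \<nu> {x..} \<le> 1" by simp
    also have "\<dots> \<le> exp (p * (real m0 + 1 - ln x))"
      using True p by simp
    finally show ?thesis using x by (simp add: powr_def exp_add[symmetric] algebra_simps)
  next
    case False
    define m where "m = nat \<lfloor>ln x\<rfloor>"
    have m: "real m \<le> ln x" "ln x - 1 \<le> real m"
      using False by (auto simp: m_def)
    then have "exp (real m) \<le> x" using x by (simp add: ln_ge_iff)
    then have "measure \<nu> {x..} \<le> h m"
      unfolding h_def by (intro nu.finite_measure_mono) (auto simp: assms(2))
    also have "\<dots> \<le> exp (- p * (real m - real m0))"
      using False m by (intro h) linarith
    also have "\<dots> \<le> exp (p * (real m0 + 1) - p * ln x)"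
      using mult_left_mono[OF m(2), of p] p by (simp add: algebra_simps)
    finally show ?thesis using x by (simp add: powr_def exp_add[symmetric])
  qed
  then show thesis using that by (metis exp_gt_zero)
qed

text \<open>The tail at \<open>exp m\<close> decays at most geometrically, and
  \<open>{exp (n + k)..}\<close> is contained in the half-line required by
  \<open>tail_constant\<close>.\<close>

lemma ex_tail_constant:
  fixes \<alpha> :: real
  assumes "prob_space \<nu>" "sets \<nu> = sets borel" "slowly_varying L"
    and lim: "((\<lambda>x. measure \<nu> {x..} / (x powr (- \<alpha>) * L x)) \<longlongrightarrow> 1) at_top"
    and \<alpha>: "0 < \<alpha>"
  shows "\<exists>D>0. tail_constant \<nu> \<alpha> D"
proof -
  interpret nu: prob_space \<nu> by fact
  define h where "h = (\<lambda>m :: nat. measure \<nu> {exp (real m)..})"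
  \<comment> \<open>Here \<alpha> + 1 is a convenient exponent above the limiting one.\<close>
  have "\<forall>\<^sub>F m in sequentially. exp (- (\<alpha> + 1)) < h (Suc m) / h m"
    unfolding h_def by (rule order_tendstoD(1)[OF tail_ratio(1)[OF assms(1,3) lim]]) simp
  with tail_ratio(2)[OF assms(1,3) lim]
  have "\<forall>\<^sub>F m in sequentially. 0 < h m \<and> exp (- (\<alpha> + 1)) * h m \<le> h (Suc m)"
    by eventually_elim (simp add: h_def field_simps)
  then obtain m0 where m0: "\<And>m. m0 \<le> m \<Longrightarrow> 0 < h m" "\<And>m. m0 \<le> m \<Longrightarrow> exp (- (\<alpha> + 1)) * h m \<le> h (Suc m)"
    by (auto simp: eventually_sequentially)
  define c where "c = h m0"
  have c: "0 < c" "c \<le> 1" using m0 by (auto simp: c_def h_def)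
  have "c * exp (- (\<alpha> + 1) * (real m - real m0)) \<le> h m" if "m0 \<le> m" for m
    using that
  proof (induction m rule: dec_induct)
    case base then show ?case by (simp add: c_def)
  next
    case (step m)
    have "c * exp (- (\<alpha> + 1) * (real (Suc m) - real m0))
        = exp (- (\<alpha> + 1)) * (c * exp (- (\<alpha> + 1) * (real m - real m0)))"
      by (simp add: exp_add[symmetric] algebra_simps)
    also have "\<dots> \<le> exp (- (\<alpha> + 1)) * h m" using step by (intro mult_left_mono) auto
    also have "\<dots> \<le> h (Suc m)" using m0 step by auto
    finally show ?case .
  qed note ge = this
  have lower: "exp (ln c - (\<alpha> + 1) * real m) \<le> h m" for m
  proof (cases "m0 \<le> m")
    case True
    have "exp (ln c - (\<alpha> + 1) * real m) \<le> exp (ln c - (\<alpha> + 1) * (real m - real m0))"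
      using \<alpha> by simp
    also have "\<dots> = c * exp (- (\<alpha> + 1) * (real m - real m0))"
      using c by (simp add: exp_diff exp_minus exp_add field_simps)
    also have "\<dots> \<le> h m" by (rule ge[OF True])
    finally show ?thesis .
  next
    case False
    have "exp (ln c - (\<alpha> + 1) * real m) \<le> exp (ln c)" using \<alpha> by simp
    also have "\<dots> = h m0" using c by (simp add: c_def)
    also have "\<dots> \<le> h m"
      unfolding h_def using False by (intro nu.finite_measure_mono) (auto simp: assms(2) intro: order_trans[rotated])
    finally show ?thesis .
  qed
  \<comment> \<open>This makes \<open>D * \<alpha> = \<alpha> + 1 - ln c\<close>. As
    \<open>ln c \<le> 0\<close> and \<open>n + k \<ge> 1\<close>, the prefactor \<open>c\<close> is
    absorbed into the exponential decay.\<close>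
  define D where "D = (\<alpha> + 1 - ln c) / \<alpha>"
  have lnc: "ln c \<le> 0" using c by simp
  have "0 < D" using \<alpha> lnc by (auto simp: D_def)
  moreover have "tail_constant \<nu> \<alpha> D"
    unfolding tail_constant_def
  proof (intro allI impI)
    fix n k :: nat assume n: "1 \<le> n" "1 \<le> k"
    have "real (n + k) * ln c \<le> 1 * ln c"
      using n lnc by (intro mult_right_mono_neg) auto
    moreover have "real (n + k) * D * \<alpha> = real (n + k) * (\<alpha> + 1 - ln c)"
      using \<alpha> by (simp add: D_def)
    ultimately have "exp (- (real (n + k) * D * \<alpha>)) \<le> exp (ln c - (\<alpha> + 1) * real (n + k))"
      by (simp add: algebra_simps)
    also have "\<dots> \<le> h (n + k)" by (rule lower)
    also have "\<dots> \<le> measure \<nu> {exp (real (n + k)) - exp (real n) <..}"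
    proof -
      have "exp (real (n + k)) - exp (real n) < exp (real (n + k))" by simp
      then have "{exp (real (n + k))..} \<subseteq> {exp (real (n + k)) - exp (real n) <..}"
        unfolding atLeast_def greaterThan_def by (blast intro: less_le_trans)
      then show ?thesis
        unfolding h_def by (rule nu.finite_measure_mono) (simp add: assms(2))
    qed
    finally show "exp (- (real (n + k) * D * \<alpha>)) \<le> measure \<nu> {exp (real (n + k)) - exp (real n) <..}" .
  qed
  ultimately show ?thesis by blast
qed

lemma ln_ereal_le: "m \<le> ereal (exp x) \<Longrightarrow> ln_ereal m \<le> ereal x"
  by (cases m) (auto simp: ln_ereal_def, metis ln_exp ln_le_cancel_iff exp_gt_zero)

lemma ln_ereal_ge: "ereal (exp x) \<le> m \<Longrightarrow> ereal x \<le> ln_ereal m"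
proof (cases m)
  case (real r)
  assume "ereal (exp x) \<le> m"
  then have "exp x \<le> r" using real by simp
  moreover from this have "0 < r" using exp_gt_zero less_le_trans by blast
  ultimately show ?thesis using real by (simp add: ln_ereal_def ln_ge_iff)
qed (auto simp: ln_ereal_def)

section \<open>The almost sure bound for the limsup\<close>

context branching_randomness
begin

definition regular :: "'w \<Rightarrow> bool" where
  "regular \<omega> \<longleftrightarrow> \<omega> \<in> space P \<and> (\<forall>u i. 0 \<le> \<xi> u i \<omega>) \<and> (\<forall>u k. 0 < \<E> u k \<omega>)"

text \<open>Labels and indices are countable, so the exceptional null sets can be united.\<close>

lemma AE_regular:
  assumes "measure \<nu> {..<0} = 0"
  shows "AE \<omega> in P. regular \<omega>"
proof -
  have "AE \<omega> in P. 0 \<le> \<xi> u i \<omega>" for u i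
  proof (rule AE_I')
    have "{\<omega> \<in> space P. \<xi> u i \<omega> \<in> {..<0}} \<in> events" using jumps_measurable[of u i] by measurable
    then show "{\<omega> \<in> space P. \<xi> u i \<omega> \<in> {..<0}} \<in> null_sets P"
      using prob_jump[of "{..<0}" u i] assms by (auto simp: null_sets_def emeasure_eq_measure)
  qed auto
  moreover have "AE \<omega> in P. 0 < \<E> u k \<omega>" for u k
  proof (rule AE_I')
    have m: "\<E> u k \<in> borel_measurable P"
      using distributed_measurable[OF clocks] by simp
    then have "{\<omega> \<in> space P. \<E> u k \<omega> \<le> 0} \<in> events" by measurable
    then show "{\<omega> \<in> space P. \<E> u k \<omega> \<le> 0} \<in> null_sets P"
      using exponential_distributedD_le[OF clocks[of u k], of 0]
      by (auto simp: null_sets_def emeasure_eq_measure)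
  qed auto
  ultimately have "AE \<omega> in P. (\<forall>u i. 0 \<le> \<xi> u i \<omega>) \<and> (\<forall>u k. 0 < \<E> u k \<omega>)"
    by (simp add: AE_all_countable)
  with AE_space show ?thesis by eventually_elim (simp add: regular_def)
qed

lemma realisation:
  assumes "regular \<omega>" "0 < \<gamma>"
  shows "realisation \<gamma> (\<lambda>v t. N v t \<omega>) (\<lambda>v i. \<xi> v i \<omega>) (\<lambda>v k. \<E> v k \<omega>)"
  using assms arrivals by unfold_locales (auto simp: regular_def poisson_process_def)

text \<open>A first exceedance along a line of descent: below level \<open>exp x\<close> the branching rate is at most
  \<open>x powr \<gamma>\<close>, so the birth time is at least \<open>delay / x powr \<gamma>\<close>.\<close>

lemma position_less:
  assumes \<omega>: "regular \<omega>" and \<gamma>: "0 < \<gamma>" and x: "1 \<le> x" and "0 \<le> t"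
    and not_bad: "\<omega> \<notin> bad (x powr \<gamma> * t) t (exp x)"
    and alive: "u \<in> alive \<gamma> N \<xi> \<E> t \<omega>"
  shows "position \<gamma> N \<xi> \<E> u t \<omega> < exp x"
proof -
  interpret realisation \<gamma> "\<lambda>v t. N v t \<omega>" "\<lambda>v i. \<xi> v i \<omega>" "\<lambda>v k. \<E> v k \<omega>"
    by (rule realisation[OF \<omega> \<gamma>])
  have step: "traj u t \<le> traj u (born u) + jumped_by t u \<omega>" if "0 \<le> born u" "born u \<le> t" for u
    using traj_eq[of u t] jumped_mono[of "t - born u" t u] that by (simp add: jumped_by_def)
  \<comment> \<open>The bounds are carried together: those on \<open>delay\<close> and
    \<open>reach\<close> would put the outcome into \<open>bad\<close> if \<open>u\<close> exceeded
    \<open>exp x\<close>, and staying below \<open>exp x\<close> bounds the rate up to the births of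
    the children.\<close>
  have "0 \<le> born u \<and> (born u \<le> t \<longrightarrow> delay [] u \<omega> \<le> x powr \<gamma> * born u \<and>
      traj u t \<le> reach t u \<omega> \<and> traj u t < exp x)"
  proof (induction u)
    case Nil
    have r: "traj [] t \<le> reach t [] \<omega>"
      by (simp add: reach_def jumped_by_def)
    have "\<not> exp x \<le> reach t [] \<omega>"
    proof
      assume "exp x \<le> reach t [] \<omega>"
      then have "\<omega> \<in> bad (x powr \<gamma> * t) t (exp x)"
        using \<omega> \<open>0 \<le> t\<close> unfolding bad_def by (auto simp: regular_def intro!: exI[of _ "[]"] simp: delay_Nil)
      with not_bad show False by simp
    qed
    then show ?case using r by (auto simp: delay_Nil)
  next
    case (Cons k u)
    have b: "0 \<le> born (k # u)" using Cons born_Cons_ge[of u k] by simp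
    moreover have "delay [] (k # u) \<omega> \<le> x powr \<gamma> * born (k # u) \<and>
      traj (k # u) t \<le> reach t (k # u) \<omega> \<and> traj (k # u) t < exp x" if t: "born (k # u) \<le> t"
    proof -
      have IH: "delay [] u \<omega> \<le> x powr \<gamma> * born u" "traj u t \<le> reach t u \<omega>" "traj u t < exp x"
        using Cons t born_Cons_ge[of u k] by auto
      have le: "traj u (born (k # u)) \<le> traj u t"
        by (rule traj_mono[OF born_Cons_ge t])
      have d: "delay [] (k # u) \<omega> \<le> x powr \<gamma> * born (k # u)"
        using born_Cons_lower[OF x, of u k] IH le by (simp add: delay_Cons algebra_simps)
      have "traj (k # u) t \<le> traj u t + jumped_by t (k # u) \<omega>"
        using step[OF b t] le by (simp add: traj_born_Cons)
      also have "\<dots> \<le> reach t u \<omega> + jumped_by t (k # u) \<omega>" using IH by simp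
      also have "\<dots> = reach t (k # u) \<omega>"
      proof -
        have "k # u \<notin> ancestors u" using length_ancestors by force
        then show ?thesis using card_ancestors[of u] by (simp add: reach_def)
      qed
      finally have r: "traj (k # u) t \<le> reach t (k # u) \<omega>" .
      have "\<not> exp x \<le> reach t (k # u) \<omega>"
      proof
        assume "exp x \<le> reach t (k # u) \<omega>"
        moreover have "x powr \<gamma> * born (k # u) \<le> x powr \<gamma> * t" using t by (intro mult_left_mono) auto
        ultimately have "\<omega> \<in> bad (x powr \<gamma> * t) t (exp x)"
          using \<omega> d unfolding bad_def by (auto simp: regular_def intro!: exI[of _ "k # u"])
        with not_bad show False by simp
      qed
      then show ?thesis using r d by auto
    qed
    ultimately show ?case by blast
  qed
  then show ?thesis using alive by (simp add: alive_def birth_def position_def)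
qed

lemma alive_mono_position:
  assumes "regular \<omega>" "0 < \<gamma>" "s \<le> t" "u \<in> alive \<gamma> N \<xi> \<E> s \<omega>"
  shows "u \<in> alive \<gamma> N \<xi> \<E> t \<omega>" "position \<gamma> N \<xi> \<E> u s \<omega> \<le> position \<gamma> N \<xi> \<E> u t \<omega>"
proof -
  interpret realisation \<gamma> "\<lambda>v t. N v t \<omega>" "\<lambda>v i. \<xi> v i \<omega>" "\<lambda>v k. \<E> v k \<omega>"
    by (rule realisation[OF assms(1,2)])
  show "u \<in> alive \<gamma> N \<xi> \<E> t \<omega>" "position \<gamma> N \<xi> \<E> u s \<omega> \<le> position \<gamma> N \<xi> \<E> u t \<omega>"
    using assms(3,4) traj_mono[of u s t] by (auto simp: alive_def birth_def position_def)
qed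

lemma AE_Limsup_le:
  assumes rate: "0 < rate" and \<alpha>: "0 < \<alpha>" and \<gamma>: "0 < \<gamma>" "\<gamma> < 1"
    and nonneg: "measure \<nu> {..<0} = 0"
    and C: "0 < C" and tail: "\<And>x. 0 < x \<Longrightarrow> measure \<nu> {x..} \<le> C * x powr - (3 / 4 * \<alpha>)"
  shows "AE \<omega> in P. Limsup at_top (normalized_log_max \<gamma> N \<xi> \<E> \<omega>) \<le> ereal ((2 / \<alpha>) powr (1 / (1 - \<gamma>)))"
proof -
  define \<beta> where "\<beta> = 1 / (1 - \<gamma>)"
  define K where "K = (2 / \<alpha>) powr \<beta>"
  have \<beta>: "1 < \<beta>" using \<gamma> by (simp add: \<beta>_def)
  have K: "0 < K" using \<alpha> by (simp add: K_def)
  define x where "x = (\<lambda>m :: nat. K * real m powr \<beta>)"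
  define b where "b = (\<lambda>m. bad (x m powr \<gamma> * real m) (real m) (exp (x m)))"
  have x_at_top: "filterlim x at_top sequentially"
    unfolding x_def using K \<beta> by real_asymp
  \<comment> \<open>Since \<beta> > 1 the level grows superlinearly; the extra 1 in
    \<open>rate + 1\<close> leaves the summable factor \<open>exp (- m)\<close>.\<close>
  have x_big: "\<forall>\<^sub>F m in sequentially. (rate + 1) * real m \<le> \<alpha> / 8 * x m"
    unfolding x_def using K \<beta> \<alpha> rate by real_asymp
  \<comment> \<open>\<open>K\<close> is chosen for this balance: the clock time available below
    level \<open>exp (x m)\<close> is half of \<open>\<alpha> * x m\<close>.\<close>
  have x_eq: "x m powr \<gamma> * real m = \<alpha> / 2 * x m" if "0 < m" for m
  proof -
    have "(1 - \<gamma>) * \<beta> = 1" using \<gamma> by (simp add: \<beta>_def)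
    then have "x m powr (1 - \<gamma>) = (2 / \<alpha>) * real m"
      using that \<alpha> by (simp add: x_def K_def powr_mult powr_powr mult.commute)
    then have "real m = \<alpha> / 2 * x m powr (1 - \<gamma>)" using \<alpha> by simp
    then have "x m powr \<gamma> * real m = \<alpha> / 2 * (x m powr \<gamma> * x m powr (1 - \<gamma>))" by simp
    also have "x m powr \<gamma> * x m powr (1 - \<gamma>) = x m"
      using K that by (simp add: powr_add[symmetric] x_def)
    finally show ?thesis .
  qed
  \<comment> \<open>With \<theta> = 5/4 the label count contributes
    \<open>5 / 8 * \<alpha> * x m\<close> to the exponent and the tail removes
    \<open>3 / 4 * \<alpha> * x m\<close>, a gain of \<open>\<alpha> / 8 * x m\<close>.\<close>
  obtain B where B: "0 < B" "\<And>a t y. 0 < a \<Longrightarrow> 0 < t \<Longrightarrow> exp 1 < y \<Longrightarrow>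
      prob (bad a t y) \<le> B * exp (rate * t + 5 / 4 * a) * (y - exp 1) powr - (3 / 4 * \<alpha>)"
    using prob_bad[OF rate _ C tail, of "5 / 4"] \<alpha> by auto
  have "\<forall>\<^sub>F m in sequentially. prob (b m) \<le> B * 2 powr (3 / 4 * \<alpha>) * exp (- 1) ^ m"
    using x_big filterlim_at_top_dense[THEN iffD1, OF x_at_top, rule_format, of 2] eventually_gt_at_top[of 0]
  proof eventually_elim
    case (elim m)
    \<comment> \<open>Ensures that \<open>exp (x m) - exp 1\<close> is at least
      \<open>exp (x m) / 2\<close>.\<close>
    have "2 * exp 1 \<le> exp 1 * exp (1 :: real)"
      using exp_ge_add_one_self[of 1] by (simp add: mult.commute)
    also have "\<dots> = exp 2" by (simp add: exp_add[symmetric])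
    also have "\<dots> < exp (x m)" using elim by simp
    finally have e: "2 * exp 1 < exp (x m)" .
    have pos: "0 < x m powr \<gamma> * real m" using elim by simp
    have "prob (b m) \<le> B * exp (rate * real m + 5 / 4 * (x m powr \<gamma> * real m)) *
        (exp (x m) - exp 1) powr - (3 / 4 * \<alpha>)"
      unfolding b_def using e elim pos by (intro B) (auto intro: less_trans[rotated])
    also have "\<dots> \<le> B * exp (rate * real m + 5 / 4 * (\<alpha> / 2 * x m)) * (exp (x m) / 2) powr - (3 / 4 * \<alpha>)"
      unfolding x_eq[OF elim(3)] using B \<alpha> e by (intro mult_left_mono powr_mono2') auto
    also have "(exp (x m) / 2) powr - (3 / 4 * \<alpha>) = 2 powr (3 / 4 * \<alpha>) * exp (- (3 / 4 * \<alpha> * x m))"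
      by (simp add: powr_divide powr_minus_divide) (simp add: powr_def exp_minus field_simps)
    also have "B * exp (rate * real m + 5 / 4 * (\<alpha> / 2 * x m)) * (2 powr (3 / 4 * \<alpha>) * exp (- (3 / 4 * \<alpha> * x m)))
        = B * 2 powr (3 / 4 * \<alpha>) * exp (rate * real m - \<alpha> / 8 * x m)"
      by (simp add: exp_add exp_diff exp_minus field_simps flip: exp_add)
    also have "\<dots> \<le> B * 2 powr (3 / 4 * \<alpha>) * exp (real m * (- 1))"
      using B elim by (intro mult_left_mono) (auto simp: algebra_simps)
    finally show ?case by (simp only: exp_of_nat_mult)
  qed
  then have "\<forall>\<^sub>F m in sequentially. norm (prob (b m)) \<le> B * 2 powr (3 / 4 * \<alpha>) * exp (- 1) ^ m"
    by simp
  then have "summable (\<lambda>m. prob (b m))"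
    by (rule summable_comparison_test_ev) (intro summable_mult summable_geometric, simp)
  then have "AE \<omega> in P. \<forall>\<^sub>F m in sequentially. \<omega> \<in> space P - b m"
    by (intro borel_cantelli_AE1) (auto simp: b_def bad_events emeasure_eq_measure)
  with AE_regular[OF nonneg] show ?thesis
  proof eventually_elim
    case (elim \<omega>)
    have "\<forall>\<^sub>F m in sequentially. \<omega> \<notin> b m \<and> 1 \<le> x m"
      using elim(2) filterlim_at_top[THEN iffD1, OF x_at_top, rule_format, of 1]
      by eventually_elim simp
    then obtain m0 where m0: "\<And>m. m0 \<le> m \<Longrightarrow> \<omega> \<notin> b m" "\<And>m. m0 \<le> m \<Longrightarrow> 1 \<le> x m"
      by (auto simp: eventually_sequentially)
    have le: "normalized_log_max \<gamma> N \<xi> \<E> \<omega> t \<le> ereal (K * ((t + 1) / t) powr \<beta>)"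
      if t: "real m0 \<le> t" "0 < t" for t
    proof -
      \<comment> \<open>Rounding up is safe: particles alive at \<open>t\<close> are still alive at
        \<open>m\<close>, and no further left.\<close>
      define m where "m = nat \<lceil>t\<rceil>"
      have m: "m0 \<le> m" "t \<le> real m" "real m \<le> t + 1" using t unfolding m_def by linarith+
      have "rightmost \<gamma> N \<xi> \<E> t \<omega> \<le> ereal (exp (x m))"
        unfolding rightmost_def
      proof (rule SUP_least)
        fix u assume u: "u \<in> alive \<gamma> N \<xi> \<E> t \<omega>"
        have "position \<gamma> N \<xi> \<E> u (real m) \<omega> < exp (x m)"
          using m0[OF m(1)] alive_mono_position(1)[OF elim(1) \<gamma>(1) m(2) u]
          by (intro position_less[OF elim(1) \<gamma>(1)]) (auto simp: b_def)
        with alive_mono_position(2)[OF elim(1) \<gamma>(1) m(2) u]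
        show "ereal (position \<gamma> N \<xi> \<E> u t \<omega>) \<le> ereal (exp (x m))" by simp
      qed
      then have "ln_ereal (rightmost \<gamma> N \<xi> \<E> t \<omega>) \<le> ereal (x m)" by (rule ln_ereal_le)
      also have "\<dots> \<le> ereal (K * (t + 1) powr \<beta>)"
        unfolding x_def using K m t \<beta> by (auto intro!: mult_left_mono powr_mono2)
      finally have "ln_ereal (rightmost \<gamma> N \<xi> \<E> t \<omega>) / ereal (t powr \<beta>)
          \<le> ereal (K * (t + 1) powr \<beta>) / ereal (t powr \<beta>)"
        using t by (intro ereal_divide_right_mono) auto
      also have "\<dots> = ereal (K * ((t + 1) / t) powr \<beta>)"
        using t by (simp add: powr_divide)
      finally show ?thesis by (simp add: normalized_log_max_def \<beta>_def)
    qed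
    have "\<forall>\<^sub>F t in at_top. normalized_log_max \<gamma> N \<xi> \<E> \<omega> t \<le> ereal (K * ((t + 1) / t) powr \<beta>)"
      using eventually_ge_at_top[of "real m0"] eventually_gt_at_top[of 0]
      by eventually_elim (rule le)
    then have "Limsup at_top (normalized_log_max \<gamma> N \<xi> \<E> \<omega>)
        \<le> Limsup at_top (\<lambda>t. ereal (K * ((t + 1) / t) powr \<beta>))"
      by (rule Limsup_mono)
    also have "\<dots> = ereal K"
    proof (rule lim_imp_Limsup)
      have "((\<lambda>t. K * ((t + 1) / t) powr \<beta>) \<longlongrightarrow> K) at_top"
        using K \<beta> by real_asymp
      then show "((\<lambda>t. ereal (K * ((t + 1) / t) powr \<beta>)) \<longlongrightarrow> ereal K) at_top" by simp
    qed simp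
    finally show ?case by (simp add: K_def \<beta>_def)
  qed
qed

end

section \<open>One stage of the lower bound\<close>

text \<open>A weak Stirling bound; the induction rests on
  \<open>exp 1 \<le> (1 + 1 / n) ^ (n + 1)\<close>.\<close>

lemma fact_le_exp: "1 \<le> n \<Longrightarrow> fact n * exp (real n) \<le> exp 1 * real n * real n ^ n"
proof (induction n rule: dec_induct)
  case base then show ?case by simp
next
  case (step n)
  have n: "0 < real n" using step by simp
  have "1 / real (Suc n) \<le> ln (1 + 1 / real n)"
    using n ln_add_one_self_le_self2[of "- 1 / real (Suc n)"] ln_inverse[of "1 + 1 / real n"]
    by (simp add: field_simps ln_div)
  then have "1 \<le> real (Suc n) * ln (1 + 1 / real n)"
    using n by (simp add: field_simps)
  then have "exp 1 \<le> exp (real (Suc n) * ln (1 + 1 / real n))" by simp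
  also have "\<dots> = (1 + 1 / real n) ^ Suc n"
  proof -
    have "0 < 1 + 1 / real n" using n by (simp add: add_pos_pos)
    then show ?thesis unfolding exp_of_nat_mult by (simp only: exp_ln)
  qed
  also have "1 + 1 / real n = real (Suc n) / real n" using n by (simp add: field_simps)
  finally have e: "exp 1 * real n ^ Suc n \<le> real (Suc n) ^ Suc n"
    using n by (simp add: power_divide field_simps)
  have "fact (Suc n) * exp (real (Suc n)) = real (Suc n) * exp 1 * (fact n * exp (real n))"
    by (simp add: exp_add[symmetric] algebra_simps)
  also have "\<dots> \<le> real (Suc n) * exp 1 * (exp 1 * real n * real n ^ n)"
    using step by (intro mult_left_mono) auto
  also have "\<dots> = exp 1 * real (Suc n) * (exp 1 * real n ^ Suc n)" by simp
  also have "\<dots> \<le> exp 1 * real (Suc n) * real (Suc n) ^ Suc n"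
    using e by (intro mult_left_mono) auto
  finally show ?case .
qed

text \<open>The loss against \<open>exp n\<close> is only linear in \<open>n\<close>, so any
  exponential rate below 1 is eventually exceeded.\<close>

lemma ex_generation:
  fixes \<theta> :: real
  assumes "1 < \<theta>"
  shows "\<exists>n\<ge>1. exp (real n / \<theta>) < real n ^ n / fact n"
proof -
  define c where "c = 1 - 1 / \<theta>"
  have "0 < c" using assms by (simp add: c_def)
  then have "\<forall>\<^sub>F n :: nat in sequentially. exp 1 * real n < exp (c * real n)"
    by real_asymp
  then have "\<forall>\<^sub>F n :: nat in sequentially. exp 1 * real n * exp (real n / \<theta>) < exp (real n)"
  proof eventually_elim
    case (elim n)
    then have "exp 1 * real n * exp (real n / \<theta>) < exp (c * real n) * exp (real n / \<theta>)" by simp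
    also have "\<dots> = exp (real n)" by (simp add: exp_add[symmetric] c_def algebra_simps)
    finally show ?case .
  qed
  then have "\<forall>\<^sub>F n in sequentially. 1 \<le> n \<and> exp (real n / \<theta>) < real n ^ n / fact n"
    using eventually_ge_at_top[of 1]
  proof eventually_elim
    case (elim n)
    have "exp 1 * real n * exp (real n / \<theta>) * fact n < exp (real n) * fact n"
      using elim by (intro mult_strict_right_mono) auto
    also have "\<dots> \<le> exp 1 * real n * real n ^ n"
      using fact_le_exp[OF elim(2)] by (simp add: mult.commute)
    finally have "exp (real n / \<theta>) * fact n < real n ^ n"
      using elim by (simp add: mult.assoc)
    then show ?case using elim by (simp add: field_simps)
  qed
  then show ?thesis unfolding eventually_sequentially by blast
qed

fun owner :: "source \<Rightarrow> label" where
  "owner (Arrivals u) = u"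
| "owner (Jump u i) = u"
| "owner (Clock u k) = u"

text \<open>All randomness of the subtree rooted at \<open>v\<close>: since labels grow at the head,
  descendants are the labels with suffix \<open>v\<close>.\<close>

definition descent :: "label \<Rightarrow> source set" where
  "descent v = {s. \<exists>w. owner s = w @ v}"

lemma descent_append: "descent (u @ v) \<subseteq> descent v"
  unfolding descent_def by auto

lemma descent_disjoint:
  assumes "length u = length u'" "u \<noteq> u'"
  shows "descent (u @ v) \<inter> descent (u' @ v) = {}"
proof (intro equals0I)
  fix s assume "s \<in> descent (u @ v) \<inter> descent (u' @ v)"
  then obtain w w' where "w @ (u @ v) = w' @ (u' @ v)"
    unfolding descent_def mem_Collect_eq Int_iff by metis
  moreover have "length (u @ v) = length (u' @ v)" using assms by simp
  ultimately have "u @ v = u' @ v" using append_eq_append_conv by blast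
  then show False using assms by simp
qed

lemma lineage_descent: "lineage v u \<subseteq> descent v"
  using lineage_suffix by (fastforce simp: descent_def)

text \<open>Clocks used before a generation is born belong to shorter labels, whereas the subtrees
  of that generation own only labels at least as long. Newborn subtrees are therefore fresh.\<close>

lemma lineage_descent_disjoint:
  assumes "length u = length u'"
  shows "lineage v u \<inter> descent (u' @ v) = {}"
proof (intro equals0I)
  fix s assume s: "s \<in> lineage v u \<inter> descent (u' @ v)"
  then obtain w i where "s = Clock (w @ v) i" using lineage_suffix by blast
  then show False
    using s lineage_length[of "w @ v" i v u] assms by (auto simp: descent_def dest: arg_cong[of _ _ length])
qed

context branching_randomness
begin

lemma delay_le_events: "lineage v u \<subseteq> S \<Longrightarrow> {\<omega> \<in> space P. delay v u \<omega> \<le> a} \<in> sets (info S)"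
  using measurable_sets[OF measurable_delay, of v u S "{..a}"]
  by (simp add: vimage_def Int_def conj_commute)

text \<open>Monotone convergence truncates a good generation to a finite set \<open>U\<close>. Since
  the law of \<open>delay v u\<close> does not depend on \<open>v\<close>, one \<open>U\<close>
  serves every particle; each block multiplies the mean number by more than \<mu> within
  \<open>a\<close> units of clock time.\<close>

lemma ex_fertile_generation:
  assumes \<theta>: "1 < \<theta>"
  obtains n U a \<mu> where "finite U" "U \<subseteq> {u. length u = n}" "0 < a" "1 < \<mu>" "a \<le> \<theta> * ln \<mu>"
    "\<And>v. \<mu> < (\<Sum>u\<in>U. prob {\<omega> \<in> space P. delay v u \<omega> \<le> a})"
proof -
  obtain n where n: "1 \<le> n" "exp (real n / \<theta>) < real n ^ n / fact n"
    using ex_generation[OF \<theta>] by blast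
  define a where "a = real n"
  define U where "U = (\<lambda>J. {u :: label. length u = n \<and> sum_list (map Suc u) \<le> J})"
  have a: "0 < a" using n by (simp add: a_def)
  define f where "f = (\<lambda>u :: label. measure (poisson_pmf a) {sum_list (map Suc u)..})"
  have prob_f: "prob {\<omega> \<in> space P. delay v u \<omega> \<le> a} = f u" for v u
    unfolding f_def by (rule prob_delay[OF a])
  have "ennreal (exp (real n / \<theta>)) < (\<integral>\<^sup>+ u. ennreal (f u) \<partial>count_space {u. length u = n})"
    using sum_prob_delay[OF a, where v="[]" and n=n] n by (simp add: prob_f ennreal_less_iff) (simp add: a_def)
  also have "\<dots> = (\<integral>\<^sup>+ u. (SUP J. ennreal (f u) * indicator (U J) u) \<partial>count_space {u. length u = n})"
  proof (rule nn_integral_cong)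
    fix u assume u: "u \<in> space (count_space {u :: label. length u = n})"
    show "ennreal (f u) = (SUP J. ennreal (f u) * indicator (U J) u)"
    proof (rule antisym)
      have "ennreal (f u) = ennreal (f u) * indicator (U (sum_list (map Suc u))) u"
        using u by (simp add: U_def)
      also have "\<dots> \<le> (SUP J. ennreal (f u) * indicator (U J) u)" by (rule SUP_upper) simp
      finally show "ennreal (f u) \<le> (SUP J. ennreal (f u) * indicator (U J) u)" .
      show "(SUP J. ennreal (f u) * indicator (U J) u) \<le> ennreal (f u)"
        by (rule SUP_least) (simp add: indicator_def)
    qed
  qed
  also have "\<dots> = (SUP J. \<integral>\<^sup>+ u. ennreal (f u) * indicator (U J) u \<partial>count_space {u. length u = n})"
    by (rule nn_integral_monotone_convergence_SUP)
      (auto simp: incseq_def le_fun_def U_def indicator_def)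
  finally obtain J where "ennreal (exp (real n / \<theta>))
      < (\<integral>\<^sup>+ u. ennreal (f u) * indicator (U J) u \<partial>count_space {u. length u = n})"
    by (auto simp: less_SUP_iff)
  also have "\<dots> = (\<Sum>u\<in>U J. ennreal (f u) * indicator (U J) u)"
    using card_labels[of n J] by (intro nn_integral_count_space') (auto simp: U_def)
  also have "\<dots> = ennreal (\<Sum>u\<in>U J. f u)"
    by (simp add: sum_ennreal f_def)
  finally have "exp (real n / \<theta>) < (\<Sum>u\<in>U J. f u)"
    by (simp add: ennreal_less_iff)
  moreover have "finite (U J)" "U J \<subseteq> {u. length u = n}"
    using card_labels[of n J] by (auto simp: U_def)
  moreover have "1 < exp (real n / \<theta>)" "a \<le> \<theta> * ln (exp (real n / \<theta>))"
    using n \<theta> by (simp_all add: a_def)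
  ultimately show thesis
    using a by (intro that[of "U J" n a "exp (real n / \<theta>)"]) (simp_all only: prob_f)
qed

text \<open>The labels are added one by one: as long as the union has probability below \<open>\<eta>\<close>, the event \<open>B u\<close>
  happens outside it with probability at least \<open>prob (B u) - \<eta>\<close>, and \<open>A u\<close> is independent of that.\<close>

lemma prob_UN_Int_ge:
  assumes "finite U"
    and B: "\<And>u. u \<in> U \<Longrightarrow> B u \<in> sets (info S)"
    and A: "\<And>u. u \<in> U \<Longrightarrow> A u \<in> sets (info (T u))"
    and disj: "\<And>u. u \<in> U \<Longrightarrow> S \<inter> T u = {}" "\<And>u u'. u \<in> U \<Longrightarrow> u' \<in> U \<Longrightarrow> u \<noteq> u' \<Longrightarrow> T u \<inter> T u' = {}"
    and s: "0 \<le> s" "\<And>u. u \<in> U \<Longrightarrow> s \<le> prob (A u)"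
  shows "min \<eta> (s * ((\<Sum>u\<in>U. prob (B u)) - real (card U) * \<eta>)) \<le> prob (\<Union>u\<in>U. B u \<inter> A u)"
  using assms
proof (induction U)
  case empty then show ?case by simp
next
  case (insert u U)
  let ?E = "\<Union>u\<in>U. B u \<inter> A u"
  let ?S = "S \<union> (\<Union>u\<in>U. T u)"
  have IH: "min \<eta> (s * ((\<Sum>u\<in>U. prob (B u)) - real (card U) * \<eta>)) \<le> prob ?E"
    using insert.prems by (intro insert.IH) auto
  have "B w \<inter> A w \<in> sets (info ?S)" if "w \<in> U" for w
    using insert.prems(1,2)[of w] that sets_info_mono[of S ?S] sets_info_mono[of "T w" ?S] by blast
  then have E: "?E \<in> sets (info ?S)" using insert.hyps by blast
  have Bu: "B u \<in> sets (info ?S)" using insert.prems(1)[of u] sets_info_mono[of S ?S] by blast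
  have "S \<inter> T u = {}" using insert.prems(3) by simp
  moreover have "T w \<inter> T u = {}" if "w \<in> U" for w
    using insert.prems(4)[of w u] insert.hyps that by auto
  ultimately have "?S \<inter> T u = {}" by blast
  from prob_indep[OF this sets.Diff[OF Bu E] insert.prems(2)]
  have prod: "prob ((B u - ?E) \<inter> A u) = prob (B u - ?E) * prob (A u)" by simp
  have ev: "?E \<in> events" "B u \<in> events" "A u \<in> events"
    using info_events E Bu insert.prems(2)[of u] by auto
  have "prob (\<Union>u\<in>insert u U. B u \<inter> A u) = prob (?E \<union> ((B u - ?E) \<inter> A u))"
    by (intro arg_cong[where f=prob]) auto
  also have "\<dots> = prob ?E + prob (B u - ?E) * prob (A u)"
    using ev prod by (subst finite_measure_Union) auto
  finally have eq: "prob (\<Union>u\<in>insert u U. B u \<inter> A u) = prob ?E + prob (B u - ?E) * prob (A u)" .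
  have "s * prob (B u - ?E) \<le> prob (B u - ?E) * prob (A u)"
    using mult_left_mono[OF insert.prems(6)[of u], of "prob (B u - ?E)"] by (simp add: mult.commute)
  moreover have "prob (B u) - prob ?E \<le> prob (B u - ?E)"
  proof -
    have "prob (B u) \<le> prob ((B u - ?E) \<union> ?E)" using ev by (intro finite_measure_mono) auto
    also have "\<dots> \<le> prob (B u - ?E) + prob ?E" using ev by (intro measure_Un_le) auto
    finally show ?thesis by simp
  qed
  ultimately have step: "prob ?E + s * (prob (B u) - prob ?E) \<le> prob (\<Union>u\<in>insert u U. B u \<inter> A u)"
    unfolding eq using insert.prems(5) by (smt (verit) mult_left_mono)
  have mono: "prob ?E \<le> prob (\<Union>u\<in>insert u U. B u \<inter> A u)"
    unfolding eq by simp
  show ?case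
  proof (cases "\<eta> \<le> prob ?E")
    case True then show ?thesis using mono by simp
  next
    case False
    then have "s * (prob (B u) - \<eta>) \<le> s * (prob (B u) - prob ?E)"
      using insert.prems(5) by (intro mult_left_mono) auto
    then show ?thesis
      using IH step False insert.hyps by (simp add: algebra_simps min_le_iff_disj)
  qed
qed

text \<open>Some line of \<open>g\<close> blocks, each with relative label in \<open>U\<close> and
  clock time at most \<open>a\<close>, ends in a particle whose event \<open>A\<close> occurs.
  Actual birth times are not mentioned.\<close>

primrec grow :: "label set \<Rightarrow> real \<Rightarrow> nat \<Rightarrow> (label \<Rightarrow> 'w set) \<Rightarrow> label \<Rightarrow> 'w set" where
  "grow U a 0 A v = A v"
| "grow U a (Suc g) A v = (\<Union>u\<in>U. {\<omega> \<in> space P. delay v u \<omega> \<le> a} \<inter> grow U a g A (u @ v))"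

text \<open>The random conditions of \<open>big_jump_first_child\<close>, phrased through the
  particle's own sources only, followed by an event in the subtree of its first child.\<close>

definition shot :: "real \<Rightarrow> real \<Rightarrow> (label \<Rightarrow> 'w set) \<Rightarrow> label \<Rightarrow> 'w set" where
  "shot \<gamma> l A v = {\<omega> \<in> space P. N v (1 / (2 * l) powr \<gamma>) \<omega> \<in> {1..}} \<inter>
     {\<omega> \<in> space P. \<xi> v 0 \<omega> \<in> {exp (2 * l) - exp l <..}} \<inter>
     {\<omega> \<in> space P. \<E> v 0 \<omega> \<in> {1..2}} \<inter> A (0 # v)"

text \<open>In stage \<open>j\<close> the particles are above level \<open>exp (2 ^ j)\<close>: after \<open>G j\<close> rounds of growth, one of
  them reaches level \<open>exp (2 ^ Suc j)\<close> by a single jump.\<close>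

primrec chain :: "label set \<Rightarrow> real \<Rightarrow> real \<Rightarrow> (nat \<Rightarrow> nat) \<Rightarrow> nat \<Rightarrow> nat \<Rightarrow> label \<Rightarrow> 'w set" where
  "chain U a \<gamma> G 0 j v = space P"
| "chain U a \<gamma> G (Suc d) j v = grow U a (G j) (shot \<gamma> (2 ^ j) (chain U a \<gamma> G d (Suc j))) v"

lemma grow_mono:
  assumes "\<And>v. A v \<subseteq> A' v"
  shows "grow U a g A v \<subseteq> grow U a g A' v"
proof (induction g arbitrary: v)
  case 0 then show ?case using assms by simp
next
  case (Suc g) then show ?case by (simp only: grow.simps) (intro UN_mono Int_mono order_refl)
qed

lemma grow_subset: "(\<And>v. A v \<subseteq> space P) \<Longrightarrow> grow U a g A v \<subseteq> space P"
  by (induction g arbitrary: v) auto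

lemma shot_subset: "shot \<gamma> l A v \<subseteq> space P"
  by (auto simp: shot_def)

lemma shot_mono: "(\<And>v. A v \<subseteq> A' v) \<Longrightarrow> shot \<gamma> l A v \<subseteq> shot \<gamma> l A' v"
  by (auto simp: shot_def)

text \<open>A further stage replaces the innermost full space by a smaller event. The decrease
  permits the passage to infinitely many stages.\<close>

lemma chain_antimono: "chain U a \<gamma> G (Suc d) j v \<subseteq> chain U a \<gamma> G d j v"
proof (induction d arbitrary: j v)
  case 0
  show ?case unfolding chain.simps by (rule grow_subset[OF shot_subset])
next
  case (Suc d)
  show ?case
    unfolding chain.simps(2)[of _ _ _ _ "Suc d"] chain.simps(2)[of _ _ _ _ d j]
    by (intro grow_mono shot_mono Suc)
qed

lemma grow_events:
  assumes "finite U" "\<And>v. A v \<in> sets (info (descent v))"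
  shows "grow U a g A v \<in> sets (info (descent v))"
proof (induction g arbitrary: v)
  case 0 then show ?case using assms by simp
next
  case (Suc g)
  have "{\<omega> \<in> space P. delay v u \<omega> \<le> a} \<inter> grow U a g A (u @ v) \<in> sets (info (descent v))" for u
    using delay_le_events[OF lineage_descent] Suc[of "u @ v"] sets_info_mono[OF descent_append[of u v]]
    by blast
  then show ?case using assms(1) by (simp add: sets.finite_UN)
qed

lemma shot_event_pieces:
  assumes "0 < l"
  shows "{\<omega> \<in> space P. N v (1 / (2 * l) powr \<gamma>) \<omega> \<in> {1..}} \<in> sets (info {Arrivals v})"
    and "{\<omega> \<in> space P. \<xi> v 0 \<omega> \<in> {exp (2 * l) - exp l <..}} \<in> sets (info {Jump v 0})"
    and "{\<omega> \<in> space P. \<E> v 0 \<omega> \<in> {1..2}} \<in> sets (info {Clock v 0})"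
proof -
  have "0 \<le> 1 / (2 * l) powr \<gamma>" by simp
  from measurable_sets[OF measurable_info_arrivals[OF this, of v "{Arrivals v}"], of "{1..}"]
  show "{\<omega> \<in> space P. N v (1 / (2 * l) powr \<gamma>) \<omega> \<in> {1..}} \<in> sets (info {Arrivals v})"
    by (simp add: vimage_def Int_def conj_commute)
  from measurable_sets[OF measurable_info_jump[of v 0 "{Jump v 0}"], of "{exp (2 * l) - exp l <..}"]
  show "{\<omega> \<in> space P. \<xi> v 0 \<omega> \<in> {exp (2 * l) - exp l <..}} \<in> sets (info {Jump v 0})"
    by (simp add: vimage_def Int_def conj_commute)
  from measurable_sets[OF measurable_info_clock[of v 0 "{Clock v 0}"], of "{1..2}"]
  show "{\<omega> \<in> space P. \<E> v 0 \<omega> \<in> {1..2}} \<in> sets (info {Clock v 0})"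
    by (simp add: vimage_def Int_def conj_commute)
qed

lemma shot_events:
  assumes "0 < l" "\<And>v. A v \<in> sets (info (descent v))"
  shows "shot \<gamma> l A v \<in> sets (info (descent v))"
proof -
  have "{Arrivals v} \<subseteq> descent v" "{Jump v 0} \<subseteq> descent v" "{Clock v 0} \<subseteq> descent v"
    "descent (0 # v) \<subseteq> descent v"
    using descent_append[of "[0]" v] by (auto simp: descent_def)
  note mono = this[THEN sets_info_mono]
  show ?thesis
    unfolding shot_def
    by (intro sets.Int subsetD[OF mono(1) shot_event_pieces(1)[OF assms(1)]]
        subsetD[OF mono(2) shot_event_pieces(2)[OF assms(1)]]
        subsetD[OF mono(3) shot_event_pieces(3)[OF assms(1)]] subsetD[OF mono(4) assms(2)])
qed

text \<open>The three conditions use different sources of \<open>v\<close>, none of which lies in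
  the subtree of the child \<open>0 # v\<close>.\<close>

lemma prob_shot:
  assumes l: "0 < l" and rate: "0 < rate" and A: "A (0 # v) \<in> sets (info (descent (0 # v)))"
  shows "prob (shot \<gamma> l A v) = (1 - exp (- (rate / (2 * l) powr \<gamma>))) *
    measure \<nu> {exp (2 * l) - exp l <..} * (exp (- 1) - exp (- 2)) * prob (A (0 # v))"
proof -
  let ?a = "{\<omega> \<in> space P. N v (1 / (2 * l) powr \<gamma>) \<omega> \<in> {1..}}"
  let ?b = "{\<omega> \<in> space P. \<xi> v 0 \<omega> \<in> {exp (2 * l) - exp l <..}}"
  let ?c = "{\<omega> \<in> space P. \<E> v 0 \<omega> \<in> {1..2}}"
  note ev = shot_event_pieces(1)[OF l, of v \<gamma>] shot_event_pieces(2,3)[OF l, of v]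
  have ab: "?a \<inter> ?b \<in> sets (info {Arrivals v, Jump v 0})"
    using ev(1,2) sets_info_mono[of "{Arrivals v}" "{Arrivals v, Jump v 0}"]
      sets_info_mono[of "{Jump v 0}" "{Arrivals v, Jump v 0}"] by blast
  then have abc: "?a \<inter> ?b \<inter> ?c \<in> sets (info {Arrivals v, Jump v 0, Clock v 0})"
    using ev(3) sets_info_mono[of "{Arrivals v, Jump v 0}" "{Arrivals v, Jump v 0, Clock v 0}"]
      sets_info_mono[of "{Clock v 0}" "{Arrivals v, Jump v 0, Clock v 0}"] by blast
  have "v \<noteq> w @ 0 # v" for w
  proof
    assume "v = w @ 0 # v"
    then have "length v = length (w @ 0 # v)" by (rule arg_cong)
    then show False by simp
  qed
  then have disj: "{Arrivals v, Jump v 0, Clock v 0} \<inter> descent (0 # v) = {}"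
    by (auto simp: descent_def)
  have "prob (shot \<gamma> l A v) = prob ?a * prob ?b * prob ?c * prob (A (0 # v))"
    unfolding shot_def
    using prob_indep[OF _ ev(1,2)] prob_indep[OF _ ab ev(3)] prob_indep[OF disj abc A] by simp
  moreover have "prob ?a = 1 - exp (- (rate / (2 * l) powr \<gamma>))"
  proof -
    let ?p = "poisson_pmf (rate * (1 / (2 * l) powr \<gamma>))"
    have "prob ?a = measure ?p {1..}" using l by (intro prob_arrivals) auto
    also have "\<dots> = measure ?p (UNIV - {0})" by (rule arg_cong2[where f=measure]) auto
    also have "\<dots> = 1 - measure ?p {0}"
      using measure_pmf.prob_compl[of "{0}" ?p] by simp
    also have "\<dots> = 1 - exp (- (rate / (2 * l) powr \<gamma>))"
      using rate l by (simp add: measure_pmf_single)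
    finally show ?thesis .
  qed
  moreover have "prob ?b = measure \<nu> {exp (2 * l) - exp l <..}" by (rule prob_jump) simp
  moreover have "prob ?c = exp (- 1) - exp (- 2)"
  proof -
    have m: "\<E> v 0 \<in> borel_measurable P" using distributed_measurable[OF clocks] by simp
    have le: "prob {\<omega> \<in> space P. \<E> v 0 \<omega> \<le> t} = 1 - exp (- t)" if "0 \<le> t" for t
      using exponential_distributedD_le[OF clocks[of v 0] that] by simp
    \<comment> \<open>The clock interval is closed, so the atomless point 1 must be removed before
      subtracting distribution functions.\<close>
    have "emeasure P {\<omega> \<in> space P. \<E> v 0 \<omega> = 1} = 0"
    proof -
      have "emeasure P (\<E> v 0 -` {1} \<inter> space P) = (\<integral>\<^sup>+ x. ennreal (exponential_density 1 x) * indicator {1} x \<partial>lborel)"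
        by (rule distributed_emeasure[OF clocks]) simp
      also have "\<dots> = (\<integral>\<^sup>+ x. 0 \<partial>(lborel :: real measure))"
      proof (rule nn_integral_cong_AE)
        show "AE x in lborel. ennreal (exponential_density 1 x) * indicator {1} x = 0"
          using AE_lborel_singleton[of "1 :: real"] by eventually_elim simp
      qed
      also have "\<dots> = 0" by simp
      finally show ?thesis by (simp add: vimage_def Int_def conj_commute)
    qed
    then have z: "prob {\<omega> \<in> space P. \<E> v 0 \<omega> = 1} = 0" by (simp add: measure_def)
    have "prob {\<omega> \<in> space P. \<E> v 0 \<omega> \<le> 2} =
        prob ({\<omega> \<in> space P. \<E> v 0 \<omega> \<le> 1} \<union> {\<omega> \<in> space P. 1 < \<E> v 0 \<omega> \<and> \<E> v 0 \<omega> \<le> 2})"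
      by (intro arg_cong[where f=prob]) auto
    also have "\<dots> = prob {\<omega> \<in> space P. \<E> v 0 \<omega> \<le> 1} + prob {\<omega> \<in> space P. 1 < \<E> v 0 \<omega> \<and> \<E> v 0 \<omega> \<le> 2}"
      using m by (intro finite_measure_Union) auto
    finally have "prob {\<omega> \<in> space P. 1 < \<E> v 0 \<omega> \<and> \<E> v 0 \<omega> \<le> 2} = exp (- 1) - exp (- 2)"
      using le[of 1] le[of 2] by simp
    moreover have "prob ?c = prob ({\<omega> \<in> space P. \<E> v 0 \<omega> = 1} \<union> {\<omega> \<in> space P. 1 < \<E> v 0 \<omega> \<and> \<E> v 0 \<omega> \<le> 2})"
      by (intro arg_cong[where f=prob]) auto
    moreover have "\<dots> = prob {\<omega> \<in> space P. \<E> v 0 \<omega> = 1} + prob {\<omega> \<in> space P. 1 < \<E> v 0 \<omega> \<and> \<E> v 0 \<omega> \<le> 2}"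
      using m by (intro finite_measure_Union) auto
    ultimately show ?thesis using z by simp
  qed
  ultimately show ?thesis by simp
qed

lemma chain_events: "finite U \<Longrightarrow> chain U a \<gamma> G d j v \<in> sets (info (descent v))"
proof (induction d arbitrary: j v)
  case 0 then show ?case using sets.top[of "info (descent v)"] by simp
next
  case (Suc d)
  then show ?case by (simp add: grow_events shot_events)
qed

text \<open>Each round multiplies the success probability by at least \<mu> until it reaches \<eta>;
  the loss \<open>card U * \<eta>\<close> from overlapping successes is deducted in the hypothesis
  on \<mu>.\<close>

lemma prob_grow_ge:
  assumes U: "finite U" "U \<subseteq> {u. length u = n}"
    and A: "\<And>v. A v \<in> sets (info (descent v))" "\<And>v. p \<le> prob (A v)" "0 \<le> p"
    and \<mu>: "1 \<le> \<mu>" "\<And>v. \<mu> \<le> (\<Sum>u\<in>U. prob {\<omega> \<in> space P. delay v u \<omega> \<le> a}) - real (card U) * \<eta>"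
    and \<eta>: "0 \<le> \<eta>"
  shows "min \<eta> (\<mu> ^ g * p) \<le> prob (grow U a g A v)"
proof (induction g arbitrary: v)
  case 0 then show ?case using A(2)[of v] by simp
next
  case (Suc g)
  let ?s = "min \<eta> (\<mu> ^ g * p)"
  let ?S = "\<Union>u\<in>U. lineage v u"
  have s: "0 \<le> ?s" using \<eta> \<mu>(1) A(3) by simp
  have len: "length u = n" if "u \<in> U" for u using U(2) that by auto
  have "min \<eta> (?s * ((\<Sum>u\<in>U. prob {\<omega> \<in> space P. delay v u \<omega> \<le> a}) - real (card U) * \<eta>))
      \<le> prob (\<Union>u\<in>U. {\<omega> \<in> space P. delay v u \<omega> \<le> a} \<inter> grow U a g A (u @ v))"
  proof (rule prob_UN_Int_ge[where S = ?S and T = "\<lambda>u. descent (u @ v)"])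
    show "{\<omega> \<in> space P. delay v u \<omega> \<le> a} \<in> sets (info ?S)" if "u \<in> U" for u
      using that by (intro delay_le_events) auto
    show "?S \<inter> descent (u @ v) = {}" if "u \<in> U" for u
      using lineage_descent_disjoint[of _ u v] len that by fastforce
    show "descent (u @ v) \<inter> descent (u' @ v) = {}" if "u \<in> U" "u' \<in> U" "u \<noteq> u'" for u u'
      using descent_disjoint[of u u' v] len that by simp
  qed (use U A s Suc in \<open>auto intro: grow_events\<close>)
  moreover have "min \<eta> (\<mu> ^ Suc g * p) \<le> ?s * \<mu>"
  proof -
    have "\<eta> * 1 \<le> \<eta> * \<mu>" using \<mu> \<eta> by (intro mult_left_mono) auto
    then show ?thesis by (simp add: min_def mult_ac)
  qed
  moreover have "?s * \<mu> \<le> ?s * ((\<Sum>u\<in>U. prob {\<omega> \<in> space P. delay v u \<omega> \<le> a}) - real (card U) * \<eta>)"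
    by (intro mult_left_mono \<mu> s)
  ultimately show ?case by simp
qed

end

section \<open>Lower bound\<close>

text \<open>The bound for the three factors of \<open>prob_shot\<close> when the jump tail is
  controlled by \<kappa> = \<open>D * \<alpha>\<close>: an early arrival, a large jump, a clock in
  \<open>{1..2}\<close>.\<close>

definition stage_chance :: "real \<Rightarrow> real \<Rightarrow> real \<Rightarrow> real \<Rightarrow> real" where
  "stage_chance rate \<gamma> \<kappa> l =
    (1 - exp (- (rate / (2 * l) powr \<gamma>))) * exp (- (2 * l * \<kappa>)) * (exp (- 1) - exp (- 2))"

lemma stage_chance_pos: "0 < rate \<Longrightarrow> 0 < l \<Longrightarrow> 0 < stage_chance rate \<gamma> \<kappa> l"
  by (simp add: stage_chance_def)

text \<open>Compensating a chance of size \<open>exp (- 2 * l * \<kappa>)\<close>, up to terms of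
  order \<open>l powr \<gamma>\<close> in the exponent, takes about
  \<open>2 * l * \<kappa> / ln \<mu>\<close> rounds. A round costs
  \<open>a \<le> \<theta> * ln \<mu>\<close> units of clock time, run at rate at least
  \<open>l powr \<gamma>\<close>.\<close>

lemma ex_stage_lengths:
  fixes \<theta> :: real
  assumes rate: "0 < rate" and \<gamma>: "0 < \<gamma>" and \<kappa>: "0 < \<kappa>"
    and \<mu>: "1 < \<mu>" "0 < a" "a \<le> \<theta> * ln \<mu>"
  obtains G C where "0 < C" "\<And>j. 1 \<le> \<mu> ^ G j * stage_chance rate \<gamma> \<kappa> (2 ^ j)"
    "\<And>j. (a * real (G j) + 2) / (2 ^ j) powr \<gamma> \<le> 2 * \<theta> * \<kappa> * (2 ^ j) powr (1 - \<gamma>) + C"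
proof -
  define q :: real where "q = exp (- 1) - exp (- 2)"
  have "exp (- 1 :: real) \<le> 1" "0 < exp (- 2 :: real)" by simp_all
  then have q: "0 < q" "q \<le> 1" unfolding q_def by (simp, linarith)
  define p where "p = (\<lambda>j :: nat. stage_chance rate \<gamma> \<kappa> (2 ^ j))"
  have p: "0 < p j" for j unfolding p_def by (rule stage_chance_pos) (use rate in auto)
  have \<theta>: "0 < \<theta>"
    using \<mu> ln_gt_zero[OF \<mu>(1)] by (metis less_le_trans zero_less_mult_pos2)
  define G where "G = (\<lambda>j. nat \<lceil>- ln (p j) / ln \<mu>\<rceil>)"
  \<comment> \<open>Collects the clock and arrival factors, the rounding of \<open>G j\<close>
    (\<open>a\<close>) and the last clock (2); all are at most of order
    \<open>l powr \<gamma>\<close>.\<close>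
  define C where "C = \<theta> * (- ln q + 2 powr \<gamma> / rate) + a + 2"
  have "ln q \<le> 0" "0 \<le> 2 powr \<gamma> / rate" using q rate by simp_all
  then have C0: "0 \<le> - ln q + 2 powr \<gamma> / rate" by linarith
  have ln_p: "0 \<le> - ln (p j) \<and> - ln (p j) \<le> 2 * 2 ^ j * \<kappa> - ln q + (2 * 2 ^ j) powr \<gamma> / rate" for j
  proof -
    define z where "z = rate / (2 * 2 ^ j) powr \<gamma>"
    have z: "0 < z" using rate by (simp add: z_def)
    have "exp (- z) \<le> 1 / (1 + z)"
      using exp_ge_add_one_self[of z] z by (simp add: exp_minus field_simps)
    then have z1: "z / (1 + z) \<le> 1 - exp (- z)" using z by (simp add: field_simps)
    have "- ln (1 - exp (- z)) \<le> - ln (z / (1 + z))"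
      using z z1 by (simp add: ln_mono)
    also have "\<dots> = ln (1 + 1 / z)"
      using z by (subst ln_inverse[symmetric]) (auto simp: field_simps)
    also have "\<dots> \<le> 1 / z" using z by (intro ln_add_one_self_le_self) simp
    also have "\<dots> = (2 * 2 ^ j) powr \<gamma> / rate" by (simp add: z_def)
    finally have "- ln (1 - exp (- z)) \<le> (2 * 2 ^ j) powr \<gamma> / rate" .
    moreover have "0 < 1 - exp (- z)" using z by simp
    then have "ln (p j) = ln (1 - exp (- z)) - 2 * 2 ^ j * \<kappa> + ln q"
      using q by (simp add: p_def stage_chance_def z_def[symmetric] q_def[symmetric] ln_mult)
    moreover have "ln (1 - exp (- z)) \<le> 0" using z by simp
    moreover have "ln q \<le> 0" using q by simp
    moreover have "0 \<le> 2 * 2 ^ j * \<kappa>" using \<kappa> by simp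
    ultimately show ?thesis by linarith
  qed
  have "1 \<le> \<mu> ^ G j * p j" for j
  proof -
    have "- ln (p j) / ln \<mu> \<le> real (G j)" unfolding G_def by linarith
    then have "0 \<le> real (G j) * ln \<mu> + ln (p j)"
      unfolding pos_divide_le_eq[OF ln_gt_zero[OF \<mu>(1)]] by linarith
    then have "exp 0 \<le> exp (real (G j) * ln \<mu> + ln (p j))" by (simp only: exp_le_cancel_iff)
    then show ?thesis using \<mu>(1) p[of j] by (simp add: exp_add exp_of_nat_mult)
  qed
  moreover have "(a * real (G j) + 2) / (2 ^ j) powr \<gamma> \<le> 2 * \<theta> * \<kappa> * (2 ^ j) powr (1 - \<gamma>) + C" for j
  proof -
    define l :: real where "l = 2 ^ j"
    have l: "1 \<le> l" by (simp add: l_def)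
    have lg: "1 \<le> l powr \<gamma>" using l \<gamma> by (simp add: ge_one_powr_ge_zero)
    have "0 \<le> - ln (p j) / ln \<mu>"
      using ln_p[of j] ln_gt_zero[OF \<mu>(1)] by (intro divide_nonneg_pos) auto
    then have "real (G j) \<le> - ln (p j) / ln \<mu> + 1"
      unfolding G_def by linarith
    then have "a * real (G j) \<le> a * (- ln (p j) / ln \<mu> + 1)"
      using \<mu>(2) by (intro mult_left_mono) auto
    then have "a * real (G j) \<le> a * (- ln (p j) / ln \<mu>) + a"
      by (simp only: distrib_left mult_1_right)
    also have "a * (- ln (p j) / ln \<mu>) \<le> (\<theta> * ln \<mu>) * (- ln (p j) / ln \<mu>)"
      using ln_p[of j] \<mu> by (intro mult_right_mono divide_nonneg_pos) auto
    also have "\<dots> = \<theta> * (- ln (p j))" using \<mu>(1) by simp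
    also have "\<dots> \<le> \<theta> * (2 * l * \<kappa> - ln q + (2 * l) powr \<gamma> / rate)"
      using ln_p[of j] \<theta> by (intro mult_left_mono) (auto simp: l_def)
    also have "\<dots> = 2 * \<theta> * \<kappa> * l + \<theta> * (- ln q) + \<theta> * (2 powr \<gamma> / rate) * l powr \<gamma>"
      using l by (simp add: powr_mult algebra_simps)
    also have "\<theta> * (- ln q) \<le> \<theta> * (- ln q) * l powr \<gamma>"
      using lg q \<theta> mult_left_mono[OF lg, of "\<theta> * (- ln q)"] by (simp add: mult_nonneg_nonpos)
    finally have "a * real (G j) + 2 \<le> 2 * \<theta> * \<kappa> * l + \<theta> * (- ln q) * l powr \<gamma> +
        \<theta> * (2 powr \<gamma> / rate) * l powr \<gamma> + (a + 2)" by simp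
    also have "a + 2 \<le> (a + 2) * l powr \<gamma>" using mult_left_mono[OF lg, of "a + 2"] \<mu>(2) by simp
    also have "2 * \<theta> * \<kappa> * l = 2 * \<theta> * \<kappa> * l powr (1 - \<gamma>) * l powr \<gamma>"
      using l by (simp add: mult.assoc powr_add[symmetric])
    finally have "a * real (G j) + 2 \<le> (2 * \<theta> * \<kappa> * l powr (1 - \<gamma>) + C) * l powr \<gamma>"
      by (simp add: C_def algebra_simps)
    then show ?thesis using lg by (simp add: l_def divide_le_eq)
  qed
  moreover have "0 < C" unfolding C_def using C0 \<theta> \<mu>(2) by (simp add: add_nonneg_pos)
  ultimately show thesis using that[of C G] by (simp add: p_def)
qed

context branching_randomness
begin

text \<open>The threshold \<eta> reproduces itself: a shot followed by the remaining chain succeeds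
  with at least the stage chance times \<eta>, and \<open>G j\<close> rounds of growth lift this
  back to \<eta>. Nothing is lost over the stages.\<close>

lemma prob_chain_ge:
  assumes U: "finite U" "U \<subseteq> {u. length u = n}" and rate: "0 < rate"
    and D: "tail_constant \<nu> \<alpha> D"
    and \<mu>: "1 \<le> \<mu>" "\<And>v. \<mu> \<le> (\<Sum>u\<in>U. prob {\<omega> \<in> space P. delay v u \<omega> \<le> a}) - real (card U) * \<eta>"
    and \<eta>: "0 \<le> \<eta>" "\<eta> \<le> 1"
    and G: "\<And>j. 1 \<le> \<mu> ^ G j * stage_chance rate \<gamma> (D * \<alpha>) (2 ^ j)"
  shows "\<eta> \<le> prob (chain U a \<gamma> G d j v)"
proof (induction d arbitrary: j v)
  case 0 then show ?case using \<eta> prob_space by simp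
next
  case (Suc d)
  let ?A = "shot \<gamma> (2 ^ j) (chain U a \<gamma> G d (Suc j))"
  let ?p = "stage_chance rate \<gamma> (D * \<alpha>) (2 ^ j) * \<eta>"
  have p: "0 < stage_chance rate \<gamma> (D * \<alpha>) (2 ^ j)" by (rule stage_chance_pos) (use rate in auto)
  have ge: "?p \<le> prob (?A v)" for v
  proof -
    \<comment> \<open>The tail constant is used with \<open>n = k = 2 ^ j\<close>, the jump that
      doubles the logarithmic level.\<close>
    have "exp (- (real (2 ^ j + 2 ^ j) * D * \<alpha>))
        \<le> measure \<nu> {exp (real (2 ^ j + 2 ^ j)) - exp (real (2 ^ j)) <..}"
      using D unfolding tail_constant_def by (metis one_le_numeral one_le_power)
    then have t: "exp (- (2 * 2 ^ j * (D * \<alpha>))) \<le> measure \<nu> {exp (2 * 2 ^ j) - exp (2 ^ j) <..}"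
      by (simp add: mult.assoc)
    have "(0 :: real) < 2 ^ j" by simp
    note shot = prob_shot[where A = "chain U a \<gamma> G d (Suc j)" and v = v and \<gamma> = \<gamma>,
        OF this rate chain_events[OF U(1)]]
    show ?thesis
      unfolding shot stage_chance_def
      using t Suc[of "Suc j" "0 # v"] \<eta> rate
      by (intro mult_mono mult_nonneg_nonneg) auto
  qed
  have "min \<eta> (\<mu> ^ G j * ?p) \<le> prob (grow U a (G j) ?A v)"
    using p \<eta> by (intro prob_grow_ge[OF U _ ge _ \<mu>] shot_events chain_events U) auto
  moreover have "\<eta> \<le> \<mu> ^ G j * ?p"
    using mult_right_mono[OF G[of j] \<eta>(1)] by (simp add: mult_ac)
  ultimately show ?case by simp
qed

text \<open>Children of the root own disjoint subtrees, so the first \<open>K\<close> attempts all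
  fail with probability at most \<open>(1 - \<eta>) ^ K\<close>.\<close>

lemma AE_some_try:
  assumes C: "\<And>k. A k \<in> sets (info (descent [k]))" "\<And>k. \<eta> \<le> prob (A k)" and \<eta>: "0 < \<eta>"
  shows "AE \<omega> in P. \<exists>k. \<omega> \<in> A k"
proof -
  define miss where "miss = (\<lambda>K. space P - (\<Union>k<K. A k))"
  have ev: "miss K \<in> sets (info (\<Union>k<K. descent [k]))" for K
  proof -
    have "A k \<in> sets (info (\<Union>k<K. descent [k]))" if "k < K" for k
      using C(1)[of k] sets_info_mono[of "descent [k]" "\<Union>k<K. descent [k]"] that by blast
    then have "(\<Union>k<K. A k) \<in> sets (info (\<Union>k<K. descent [k]))" by blast
    then show ?thesis unfolding miss_def using sets.compl_sets by fastforce
  qed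
  have \<eta>1: "\<eta> \<le> 1" using C(2)[of 0] prob_le_1 order_trans by blast
  have miss_le: "prob (miss K) \<le> (1 - \<eta>) ^ K" for K
  proof (induction K)
    case 0 then show ?case by simp
  next
    case (Suc K)
    have disj: "(\<Union>k<K. descent [k]) \<inter> descent [K] = {}"
      using descent_disjoint[of "[_]" "[K]" "[]"] by fastforce
    have compl: "space P - A K \<in> sets (info (descent [K]))"
      using sets.compl_sets[OF C(1)[of K]] by simp
    have "prob (miss (Suc K)) = prob (miss K \<inter> (space P - A K))"
      by (intro arg_cong[where f=prob]) (auto simp: miss_def less_Suc_eq)
    also have "\<dots> = prob (miss K) * (1 - prob (A K))"
      using prob_indep[OF disj ev compl] prob_compl[OF info_events[OF C(1)[of K]]] by simp
    also have "\<dots> \<le> (1 - \<eta>) ^ K * (1 - \<eta>)"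
      using Suc C(2)[of K] \<eta>1 by (intro mult_mono) auto
    finally show ?case by (simp add: mult.commute)
  qed
  have A_ev: "A k \<in> events" for k using info_events[OF C(1)] .
  let ?M = "space P - (\<Union>k. A k)"
  have "prob ?M \<le> (1 - \<eta>) ^ K" for K
  proof -
    have "prob ?M \<le> prob (miss K)"
      using info_events[OF ev[of K]] by (intro finite_measure_mono) (auto simp: miss_def)
    then show ?thesis using miss_le[of K] by simp
  qed
  moreover have "(\<lambda>K. (1 - \<eta>) ^ K) \<longlonglongrightarrow> 0"
    using \<eta> \<eta>1 by (intro LIMSEQ_power_zero) auto
  ultimately have "prob ?M \<le> 0" by (intro LIMSEQ_le_const) auto
  then have "?M \<in> null_sets P"
    using A_ev by (auto simp: null_sets_def emeasure_eq_measure measure_le_0_iff)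
  then show ?thesis by (rule AE_I') auto
qed

section \<open>From events back to particles, and the bound for the liminf\<close>

text \<open>Children are born at the parent's current position, so the level \<open>exp l\<close>
  persists along the line and clock time dominates \<open>l powr \<gamma>\<close> times real
  time.\<close>

lemma grow_descend:
  assumes \<omega>: "regular \<omega>" "0 < \<gamma>" and l: "1 \<le> l" "exp l \<le> position \<gamma> N \<xi> \<E> v (birth \<gamma> N \<xi> \<E> v \<omega>) \<omega>"
    and "\<omega> \<in> grow U a g A v"
  obtains w where "l powr \<gamma> * (birth \<gamma> N \<xi> \<E> w \<omega> - birth \<gamma> N \<xi> \<E> v \<omega>) \<le> a * real g"
    "exp l \<le> position \<gamma> N \<xi> \<E> w (birth \<gamma> N \<xi> \<E> w \<omega>) \<omega>" "\<omega> \<in> A w"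
proof -
  interpret realisation \<gamma> "\<lambda>v t. N v t \<omega>" "\<lambda>v i. \<xi> v i \<omega>" "\<lambda>v k. \<E> v k \<omega>"
    by (rule realisation[OF \<omega>])
  have step: "l powr \<gamma> * (born (u @ v) - born v) \<le> delay v u \<omega> \<and> exp l \<le> traj (u @ v) (born (u @ v))"
    if "exp l \<le> traj v (born v)" for u v
  proof (induction u)
    case Nil then show ?case using that by (simp add: delay_Nil)
  next
    case (Cons k u)
    have "l powr \<gamma> * (born (k # u @ v) - born (u @ v)) \<le> (\<Sum>i\<le>k. \<E> (u @ v) i \<omega>)"
      using born_Cons_le[OF l(1)] Cons by blast
    moreover have "exp l \<le> traj (k # u @ v) (born (k # u @ v))"
      using traj_born_Cons_ge[of "u @ v" k] Cons by linarith
    ultimately show ?case using Cons by (simp add: delay_Cons algebra_simps)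
  qed
  have "\<exists>w. l powr \<gamma> * (born w - born v) \<le> a * real g \<and> exp l \<le> traj w (born w) \<and> \<omega> \<in> A w"
    if "exp l \<le> traj v (born v)" "\<omega> \<in> grow U a g A v"
    using that
  proof (induction g arbitrary: v)
    case 0 then show ?case by (intro exI[of _ v]) simp
  next
    case (Suc g)
    then obtain u where u: "delay v u \<omega> \<le> a" "\<omega> \<in> grow U a g A (u @ v)" by auto
    have "exp l \<le> traj (u @ v) (born (u @ v))" using step[OF Suc.prems(1)] by blast
    from Suc.IH[OF this u(2)] obtain w where
      w: "l powr \<gamma> * (born w - born (u @ v)) \<le> a * real g" "exp l \<le> traj w (born w)" "\<omega> \<in> A w" by blast
    have "l powr \<gamma> * (born w - born v) \<le> a * real (Suc g)"
      using w(1) u(1) step[OF Suc.prems(1), of u] by (simp add: algebra_simps)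
    with w show ?case by blast
  qed
  then show thesis using assms(4,5) that by (auto simp: birth_def position_def)
qed

text \<open>A stage costs \<open>a * G\<close> units of clock time for growth and at most 2 for the
  first clock of the jumping particle; the powers of \<open>l\<close> convert this into real
  time.\<close>

lemma chain_descend:
  assumes \<omega>: "regular \<omega>" "0 < \<gamma>"
    and "exp (2 ^ j) \<le> position \<gamma> N \<xi> \<E> v (birth \<gamma> N \<xi> \<E> v \<omega>) \<omega>"
    and "\<omega> \<in> chain U a \<gamma> G d j v"
  shows "\<exists>w. birth \<gamma> N \<xi> \<E> w \<omega> \<le> birth \<gamma> N \<xi> \<E> v \<omega> + (\<Sum>i<d. (a * real (G (j + i)) + 2) / (2 ^ (j + i)) powr \<gamma>) \<and>
    exp (2 ^ (j + d)) \<le> position \<gamma> N \<xi> \<E> w (birth \<gamma> N \<xi> \<E> w \<omega>) \<omega>"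
  using assms(3,4)
proof (induction d arbitrary: j v)
  case 0 then show ?case by auto
next
  case (Suc d)
  interpret realisation \<gamma> "\<lambda>v t. N v t \<omega>" "\<lambda>v i. \<xi> v i \<omega>" "\<lambda>v k. \<E> v k \<omega>"
    by (rule realisation[OF \<omega>])
  let ?l = "2 ^ j :: real" and ?b = "\<lambda>w. birth \<gamma> N \<xi> \<E> w \<omega>"
  have l: "1 \<le> ?l" by simp
  obtain w where w: "?l powr \<gamma> * (?b w - ?b v) \<le> a * real (G j)" "exp ?l \<le> position \<gamma> N \<xi> \<E> w (?b w) \<omega>"
      "\<omega> \<in> shot \<gamma> ?l (chain U a \<gamma> G d (Suc j)) w"
    using grow_descend[OF \<omega> l Suc.prems(1), of U a "G j" "shot \<gamma> ?l (chain U a \<gamma> G d (Suc j))"] Suc.prems(2)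
    by auto
  have jump: "exp (2 * ?l) \<le> position \<gamma> N \<xi> \<E> (0 # w) (?b (0 # w)) \<omega>" "?l powr \<gamma> * (?b (0 # w) - ?b w) \<le> 2"
    using big_jump_first_child[OF l, of w] w(2,3) by (auto simp: shot_def birth_def position_def)
  have "exp (2 ^ Suc j) \<le> position \<gamma> N \<xi> \<E> (0 # w) (?b (0 # w)) \<omega>" using jump(1) by simp
  from Suc.IH[OF this] w(3) obtain w' where
    w': "?b w' \<le> ?b (0 # w) + (\<Sum>i<d. (a * real (G (Suc j + i)) + 2) / (2 ^ (Suc j + i)) powr \<gamma>)"
      "exp (2 ^ (Suc j + d)) \<le> position \<gamma> N \<xi> \<E> w' (?b w') \<omega>"
    by (auto simp: shot_def)
  have "?l powr \<gamma> * (?b (0 # w) - ?b v) \<le> a * real (G j) + 2"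
    using w(1) jump(2) by (simp add: algebra_simps)
  then have "?b (0 # w) - ?b v \<le> (a * real (G j) + 2) / ?l powr \<gamma>"
    by (simp add: le_divide_eq mult.commute)
  with w'(1) have "?b w' \<le> ?b v + (\<Sum>i<Suc d. (a * real (G (j + i)) + 2) / (2 ^ (j + i)) powr \<gamma>)"
    by (subst sum.lessThan_Suc_shift) simp
  then show ?case using w'(2) by auto
qed

lemma AE_Liminf_ge:
  assumes rate: "0 < rate" and \<alpha>: "0 < \<alpha>" and \<gamma>: "0 < \<gamma>" "\<gamma> < 1"
    and nonneg: "measure \<nu> {..<0} = 0"
    and D: "0 < D" "tail_constant \<nu> \<alpha> D"
  shows "AE \<omega> in P. ereal (((2 powr (1 - \<gamma>) - 1) / (4 * D * \<alpha>)) powr (1 / (1 - \<gamma>)))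
    \<le> Liminf at_top (normalized_log_max \<gamma> N \<xi> \<E> \<omega>)"
proof -
  \<comment> \<open>Strictly between 1 and \<open>2 powr \<gamma>\<close>: the first is needed for
    fertile blocks, the second leaves slack in the final constant.\<close>
  define \<theta> :: real where "\<theta> = 2 powr (\<gamma> / 2)"
  define b :: real where "b = 2 powr (1 - \<gamma>)"
  define \<beta> where "\<beta> = 1 / (1 - \<gamma>)"
  define k4 where "k4 = (b - 1) / (4 * D * \<alpha>)"
  define \<kappa> where "\<kappa> = 2 * \<theta> * (D * \<alpha>) / (b - 1)"
  have \<theta>: "1 < \<theta>" using \<gamma> by (simp add: \<theta>_def)
  have b: "1 < b" using \<gamma> by (simp add: b_def)
  have \<beta>: "0 < \<beta>" using \<gamma> by (simp add: \<beta>_def)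
  have k4: "0 < k4" using b D \<alpha> by (simp add: k4_def)
  have \<kappa>: "0 < \<kappa>" using b D \<alpha> \<theta> by (simp add: \<kappa>_def)
  have D\<alpha>: "0 < D * \<alpha>" using D \<alpha> by simp
  obtain n U a \<mu> where U: "finite U" "U \<subseteq> {u. length u = n}" and \<mu>: "0 < a" "1 < \<mu>" "a \<le> \<theta> * ln \<mu>"
    and fertile: "\<And>v. \<mu> < (\<Sum>u\<in>U. prob {\<omega> \<in> space P. delay v u \<omega> \<le> a})"
    by (rule ex_fertile_generation[OF \<theta>]) blast
  define S where "S = (\<Sum>u\<in>U. measure (poisson_pmf a) {sum_list (map Suc u)..})"
  have S: "(\<Sum>u\<in>U. prob {\<omega> \<in> space P. delay v u \<omega> \<le> a}) = S" for v
    by (simp only: S_def prob_delay[OF \<mu>(1)])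
  have S\<mu>: "\<mu> < S" using fertile S by simp
  \<comment> \<open>Small enough that deducting \<open>card U * \<eta>\<close> from \<open>S\<close>
    still leaves \<mu>; adding 1 in the denominator avoids division by zero.\<close>
  define \<eta> where "\<eta> = min 1 ((S - \<mu>) / (real (card U) + 1))"
  have \<eta>: "0 < \<eta>" "\<eta> \<le> 1" using S\<mu> by (auto simp: \<eta>_def)
  have "real (card U) * \<eta> \<le> (real (card U) + 1) * ((S - \<mu>) / (real (card U) + 1))"
    using S\<mu> \<eta>(1) by (intro mult_mono) (auto simp: \<eta>_def)
  also have "\<dots> = S - \<mu>" by simp
  finally have \<eta>U: "\<mu> \<le> S - real (card U) * \<eta>" by simp
  obtain G C where C: "0 < C" and G: "\<And>j. 1 \<le> \<mu> ^ G j * stage_chance rate \<gamma> (D * \<alpha>) (2 ^ j)"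
    and len: "\<And>j. (a * real (G j) + 2) / (2 ^ j) powr \<gamma> \<le> 2 * \<theta> * (D * \<alpha>) * (2 ^ j) powr (1 - \<gamma>) + C"
    by (rule ex_stage_lengths[OF rate \<gamma>(1) D\<alpha> \<mu>(2,1,3)]) blast
  \<comment> \<open>Child \<open>[k]\<close> succeeds in all stages; the uniform bound \<eta> passes
    to the decreasing intersection.\<close>
  let ?A = "\<lambda>k :: nat. \<Inter>d. chain U a \<gamma> G d 0 [k]"
  have chain_ev: "chain U a \<gamma> G d 0 [k] \<in> sets (info (descent [k]))" for d k
    by (rule chain_events[OF U(1)])
  have "AE \<omega> in P. \<exists>k. \<omega> \<in> ?A k"
  proof (rule AE_some_try)
    show "?A k \<in> sets (info (descent [k]))" for k
      using chain_ev by (intro sets.countable_INT) auto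
    show "\<eta> \<le> prob (?A k)" for k
    proof (rule LIMSEQ_le_const)
      show "(\<lambda>d. prob (chain U a \<gamma> G d 0 [k])) \<longlonglongrightarrow> prob (?A k)"
        using info_events[OF chain_ev]
        by (intro finite_Lim_measure_decseq decseq_SucI chain_antimono) auto
      show "\<exists>M. \<forall>d\<ge>M. \<eta> \<le> prob (chain U a \<gamma> G d 0 [k])"
        using \<eta> \<mu> \<eta>U S by (intro exI allI impI prob_chain_ge[OF U rate D(2) _ _ _ _ G]) auto
    qed
  qed (rule \<eta>)
  with AE_regular[OF nonneg] show ?thesis
  proof eventually_elim
    case (elim \<omega>)
    interpret realisation \<gamma> "\<lambda>v t. N v t \<omega>" "\<lambda>v i. \<xi> v i \<omega>" "\<lambda>v k. \<E> v k \<omega>"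
      by (rule realisation[OF elim(1) \<gamma>(1)])
    obtain k where k: "\<And>d. \<omega> \<in> chain U a \<gamma> G d 0 [k]" using elim(2) by blast
    define \<tau> where "\<tau> = birth \<gamma> N \<xi> \<E> [k] \<omega>"
    have \<tau>: "0 \<le> \<tau>" using born_Cons_ge[of "[]" k] by (simp add: \<tau>_def birth_def)
    \<comment> \<open>A time by which level \<open>exp (2 ^ d)\<close> has been reached: the stages
      sum to a geometric series of ratio \<open>b\<close>, with overhead \<open>C\<close>
      each.\<close>
    define T where "T = (\<lambda>d :: nat. \<tau> + \<kappa> * b ^ d + C * real d)"
    have bd: "(2 ^ d) powr (1 - \<gamma>) = b ^ d" for d :: nat
      by (simp add: b_def powr_realpow[symmetric] powr_powr mult.commute)
    have reach: "\<exists>w. birth \<gamma> N \<xi> \<E> w \<omega> \<le> T d \<and> exp (2 ^ d) \<le> position \<gamma> N \<xi> \<E> w (birth \<gamma> N \<xi> \<E> w \<omega>) \<omega>" for d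
    proof -
      have "(\<Sum>i<d. (a * real (G i) + 2) / (2 ^ i) powr \<gamma>)
          \<le> (\<Sum>i<d. 2 * \<theta> * (D * \<alpha>) * b ^ i + C)"
        using len by (intro sum_mono) (simp add: bd)
      also have "\<dots> = 2 * \<theta> * (D * \<alpha>) * ((b ^ d - 1) / (b - 1)) + C * real d"
        using b by (subst geometric_sum[symmetric]) (simp_all add: sum.distrib sum_distrib_left)
      also have "\<dots> \<le> \<kappa> * b ^ d + C * real d"
      proof -
        have "2 * \<theta> * (D * \<alpha>) * ((b ^ d - 1) / (b - 1)) = \<kappa> * (b ^ d - 1)" by (simp add: \<kappa>_def)
        then show ?thesis using \<kappa> by (simp add: algebra_simps)
      qed
      finally have sum: "(\<Sum>i<d. (a * real (G i) + 2) / (2 ^ i) powr \<gamma>) \<le> \<kappa> * b ^ d + C * real d" .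
      have "exp (2 ^ 0) \<le> position \<gamma> N \<xi> \<E> [k] (birth \<gamma> N \<xi> \<E> [k] \<omega>) \<omega>"
        using traj_born_ge_e[of "[k]"] by (simp add: birth_def position_def)
      from chain_descend[OF elim(1) \<gamma>(1) this k[of d]] sum show ?thesis
        unfolding T_def \<tau>_def by force
    qed
    \<comment> \<open>Since \<open>k4 * \<kappa> * b = \<theta> / 2 powr \<gamma> = 1 - c\<close>,
      the slack \<open>c * b ^ d\<close> absorbs \<tau> and the linear overhead.\<close>
    define c where "c = 1 - \<theta> / 2 powr \<gamma>"
    have "\<theta> < 2 powr \<gamma>" using \<gamma> by (simp add: \<theta>_def)
    then have c: "0 < c" by (simp add: c_def)
    have "\<forall>\<^sub>F d :: nat in sequentially. k4 * (\<tau> + C * (real d + 1)) \<le> c * b ^ d"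
      using c b k4 C by real_asymp
    then obtain d0 where d0: "\<And>d. d0 \<le> d \<Longrightarrow> k4 * (\<tau> + C * (real d + 1)) \<le> c * b ^ d"
      by (auto simp: eventually_sequentially)
    have T_le: "k4 * T (Suc d) \<le> b ^ d" if "d0 \<le> d" for d
    proof -
      have "k4 * \<kappa> * b = 1 - c"
      proof -
        define e where "e = b - 1"
        have "0 < e" using b by (simp add: e_def)
        then have "k4 * \<kappa> = \<theta> / 2"
          using D \<alpha> by (simp add: k4_def \<kappa>_def e_def[symmetric])
        then show ?thesis by (simp add: c_def b_def powr_diff)
      qed
      then have "k4 * (\<kappa> * b ^ Suc d) = (1 - c) * b ^ d" by (metis mult.assoc power_Suc)
      then show ?thesis using d0[OF that] by (simp add: T_def algebra_simps)
    qed
    have lower: "ereal (k4 powr \<beta>) \<le> normalized_log_max \<gamma> N \<xi> \<E> \<omega> t" if t: "T d0 < t" for t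
    proof -
      have "0 \<le> T d0" using \<tau> \<kappa> b C by (simp add: T_def)
      then have t0: "0 < t" using t by simp
      obtain e :: nat where "t / C \<le> real e" using real_arch_simple by blast
      then have "t \<le> C * real e" using C by (simp add: divide_le_eq mult.commute)
      also have "\<dots> \<le> C * real (d0 + e)" using C by (intro mult_left_mono) auto
      also have "\<dots> \<le> T (d0 + e)" using \<tau> \<kappa> b by (simp add: T_def)
      finally have ex: "t \<le> T (d0 + e)" .
      \<comment> \<open>The least such index brackets \<open>t\<close> between consecutive times
        \<open>T d\<close> and \<open>T (Suc d)\<close>.\<close>
      define m where "m = (LEAST e. t \<le> T (d0 + e))"
      have m: "t \<le> T (d0 + m)" unfolding m_def by (rule LeastI[of "\<lambda>e. t \<le> T (d0 + e)", OF ex])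
      then have "m \<noteq> 0" using t by (intro notI) simp
      then obtain m' where m': "m = Suc m'" using not0_implies_Suc by blast
      have "\<not> t \<le> T (d0 + m')"
        by (rule not_less_Least[of m' "\<lambda>e. t \<le> T (d0 + e)"]) (use m' in \<open>simp add: m_def[symmetric]\<close>)
      define d where "d = d0 + m'"
      have d: "T d < t" "t \<le> T (Suc d)" "d0 \<le> d"
        using m m' \<open>\<not> t \<le> T (d0 + m')\<close> by (auto simp: d_def)
      obtain w where w: "birth \<gamma> N \<xi> \<E> w \<omega> \<le> T d" "exp (2 ^ d) \<le> position \<gamma> N \<xi> \<E> w (birth \<gamma> N \<xi> \<E> w \<omega>) \<omega>"
        using reach by blast
      have "birth \<gamma> N \<xi> \<E> w \<omega> \<le> t" using w d by simp
      moreover have "w \<in> alive \<gamma> N \<xi> \<E> (birth \<gamma> N \<xi> \<E> w \<omega>) \<omega>" by (simp add: alive_def)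
      ultimately have "w \<in> alive \<gamma> N \<xi> \<E> t \<omega>" "exp (2 ^ d) \<le> position \<gamma> N \<xi> \<E> w t \<omega>"
        using alive_mono_position[OF elim(1) \<gamma>(1)] w(2) order_trans by blast+
      then have "ereal (exp (2 ^ d)) \<le> rightmost \<gamma> N \<xi> \<E> t \<omega>"
        unfolding rightmost_def by (intro SUP_upper2) auto
      then have "ereal (2 ^ d) \<le> ln_ereal (rightmost \<gamma> N \<xi> \<E> t \<omega>)" by (rule ln_ereal_ge)
      moreover have "(k4 * t) powr \<beta> \<le> 2 ^ d"
      proof -
        have "k4 * t \<le> k4 * T (Suc d)" using d(2) k4 by (intro mult_left_mono) auto
        then have "k4 * t \<le> b ^ d" using T_le[OF d(3)] by linarith
        then have "(k4 * t) powr \<beta> \<le> (b ^ d) powr \<beta>" using k4 t0 \<beta> by (intro powr_mono2) auto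
        also have "\<dots> = (2 ^ d) powr ((1 - \<gamma>) * \<beta>)" by (simp add: bd[symmetric] powr_powr)
        also have "\<dots> = 2 ^ d" using \<gamma> by (simp add: \<beta>_def)
        finally show ?thesis .
      qed
      ultimately have "ereal ((k4 * t) powr \<beta>) \<le> ln_ereal (rightmost \<gamma> N \<xi> \<E> t \<omega>)"
        by (meson ereal_less_eq(3) order_trans)
      then have "ereal ((k4 * t) powr \<beta>) / ereal (t powr \<beta>) \<le> ln_ereal (rightmost \<gamma> N \<xi> \<E> t \<omega>) / ereal (t powr \<beta>)"
        using t0 by (intro ereal_divide_right_mono) auto
      then show ?thesis
        using t0 k4 by (simp add: normalized_log_max_def \<beta>_def powr_mult)
    qed
    have "\<forall>\<^sub>F t in at_top. ereal (k4 powr \<beta>) \<le> normalized_log_max \<gamma> N \<xi> \<E> \<omega> t"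
      using eventually_gt_at_top[of "T d0"] by eventually_elim (rule lower)
    then have "ereal (k4 powr \<beta>) \<le> Liminf at_top (normalized_log_max \<gamma> N \<xi> \<E> \<omega>)"
      by (rule Liminf_bounded)
    then show ?case by (simp add: k4_def \<beta>_def b_def)
  qed
qed

end

theorem theorem3p3:
  fixes P :: "'w measure"
    and rate \<alpha> \<gamma> :: real
    and \<nu> :: "real measure"
    and L :: "real \<Rightarrow> real"
    and N :: "label \<Rightarrow> real \<Rightarrow> 'w \<Rightarrow> nat"
    and \<xi> \<E> :: "label \<Rightarrow> nat \<Rightarrow> 'w \<Rightarrow> real"
  assumes "rate > 0" and "\<alpha> > 0" and "0 < \<gamma>" and "\<gamma> < 1"
    and "prob_space \<nu>" and "sets \<nu> = sets borel"
    and "measure \<nu> {..<0} = 0"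
    and "slowly_varying L"
    and "((\<lambda>x. measure \<nu> {x..} / (x powr (- \<alpha>) * L x)) \<longlongrightarrow> 1) at_top"
    and "branching_randomness P rate \<nu> N \<xi> \<E>"
  shows
    "(\<exists>K3>0. \<exists>K4>0. AE \<omega> in P.
        ereal K3 \<ge> Limsup at_top (normalized_log_max \<gamma> N \<xi> \<E> \<omega>) \<and>
        Limsup at_top (normalized_log_max \<gamma> N \<xi> \<E> \<omega>) \<ge> Liminf at_top (normalized_log_max \<gamma> N \<xi> \<E> \<omega>) \<and>
        Liminf at_top (normalized_log_max \<gamma> N \<xi> \<E> \<omega>) \<ge> ereal K4) \<and>
     (\<exists>D>0. tail_constant \<nu> \<alpha> D) \<and>
     (\<forall>D>0. tail_constant \<nu> \<alpha> D \<longrightarrow>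
        (2 / \<alpha>) powr (1 / (1 - \<gamma>)) > 0 \<and>
        ((2 powr (1 - \<gamma>) - 1) / (4 * D * \<alpha>)) powr (1 / (1 - \<gamma>)) > 0 \<and>
        (AE \<omega> in P.
          ereal ((2 / \<alpha>) powr (1 / (1 - \<gamma>))) \<ge> Limsup at_top (normalized_log_max \<gamma> N \<xi> \<E> \<omega>) \<and>
          Limsup at_top (normalized_log_max \<gamma> N \<xi> \<E> \<omega>) \<ge> Liminf at_top (normalized_log_max \<gamma> N \<xi> \<E> \<omega>) \<and>
          Liminf at_top (normalized_log_max \<gamma> N \<xi> \<E> \<omega>)
            \<ge> ereal (((2 powr (1 - \<gamma>) - 1) / (4 * D * \<alpha>)) powr (1 / (1 - \<gamma>)))))"
proof -
  interpret branching_randomness P rate \<nu> N \<xi> \<E> by fact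
  \<comment> \<open>The exponent is below \<alpha>, as the tail bound requires, yet above the
    \<open>5 / 8 * \<alpha>\<close> spent on counting labels.\<close>
  obtain C where "0 < C" and tail: "\<And>x. 0 < x \<Longrightarrow> measure \<nu> {x..} \<le> C * x powr - (3 / 4 * \<alpha>)"
    using tail_upper_bound[OF assms(5,6,8,9), of "3 / 4 * \<alpha>"] assms(2) by auto
  have upper: "AE \<omega> in P. Limsup at_top (normalized_log_max \<gamma> N \<xi> \<E> \<omega>) \<le> ereal ((2 / \<alpha>) powr (1 / (1 - \<gamma>)))"
    by (rule AE_Limsup_le[OF assms(1-4,7) \<open>0 < C\<close> tail])
  have le: "Liminf at_top f \<le> Limsup at_top f" for f :: "real \<Rightarrow> ereal"
    by (rule Liminf_le_Limsup) simp
  have both: "(2 / \<alpha>) powr (1 / (1 - \<gamma>)) > 0 \<and>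
      ((2 powr (1 - \<gamma>) - 1) / (4 * D * \<alpha>)) powr (1 / (1 - \<gamma>)) > 0 \<and>
      (AE \<omega> in P.
        ereal ((2 / \<alpha>) powr (1 / (1 - \<gamma>))) \<ge> Limsup at_top (normalized_log_max \<gamma> N \<xi> \<E> \<omega>) \<and>
        Limsup at_top (normalized_log_max \<gamma> N \<xi> \<E> \<omega>) \<ge> Liminf at_top (normalized_log_max \<gamma> N \<xi> \<E> \<omega>) \<and>
        Liminf at_top (normalized_log_max \<gamma> N \<xi> \<E> \<omega>)
          \<ge> ereal (((2 powr (1 - \<gamma>) - 1) / (4 * D * \<alpha>)) powr (1 / (1 - \<gamma>))))"
    if D: "0 < D" "tail_constant \<nu> \<alpha> D" for D
  proof (intro conjI)
    have "1 < 2 powr (1 - \<gamma>)" using assms(4) by simp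
    then show "((2 powr (1 - \<gamma>) - 1) / (4 * D * \<alpha>)) powr (1 / (1 - \<gamma>)) > 0"
      using D assms(2,4) by simp
  next
    show "AE \<omega> in P.
        ereal ((2 / \<alpha>) powr (1 / (1 - \<gamma>))) \<ge> Limsup at_top (normalized_log_max \<gamma> N \<xi> \<E> \<omega>) \<and>
        Limsup at_top (normalized_log_max \<gamma> N \<xi> \<E> \<omega>) \<ge> Liminf at_top (normalized_log_max \<gamma> N \<xi> \<E> \<omega>) \<and>
        Liminf at_top (normalized_log_max \<gamma> N \<xi> \<E> \<omega>)
          \<ge> ereal (((2 powr (1 - \<gamma>) - 1) / (4 * D * \<alpha>)) powr (1 / (1 - \<gamma>)))"
      using upper AE_Liminf_ge[OF assms(1-4,7) D] by eventually_elim (simp add: le)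
  qed (use assms(2) in simp)
  obtain D where D: "0 < D" "tail_constant \<nu> \<alpha> D"
    using ex_tail_constant[OF assms(5,6,8,9,2)] by blast
  show ?thesis
    using both[OF D] both D by blast
qed

end
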